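(* Let $\Gamma$ be a connected cubic tricirculant of Type 1 with at least $54$ vertices. Then $\Gamma$ is vertex-transitive if and only if $\Gamma$ is isomorphic to $\mathrm{X}(k)$ for some odd integer $k\ge 9$. In this case, if $3\nmid k$, then $\Gamma$ is a bicirculant and is isomorphic to the generalized Petersen graph $\mathrm{GP}(3k,k+(-1)^\alpha)$, where $\alpha\in\{1,2\}$ and $\alpha\equiv k \pmod 3$.
   Context: All graphs are finite and simple; cubic means connected and $3$-regular. A connected graph is a tricirculant (resp. bicirculant) if it admits a cyclic group of automorphisms with exactly three (resp. two) orbits on vertices, all of equal size larger than $1$. For a positive integer $k$ and $r,s\in\mathbb{Z}_{2k}$, $T_1(k,r,s)$ is the graph with vertex set $\{u_i,v_i,w_i: i\in\mathbb{Z}_{2k}\}$ and edges $u_iu_{i+k}$, $u_iv_i$, $u_iw_i$, $v_iw_{i+r}$, $v_iw_{i+s}$ ($i\in\mathbb{Z}_{2k}$). A cubic tricirculant is of Type 1 if it is isomorphic to $T_1(k,r,s)$ for some positive integer $k$ and some $r,s\in\mathbb{Z}_{2k}$. For odd positive $k$, let $r^*\in\mathbb{Z}_{2k}$ be $\frac{k+3}{2}$ if $k\equiv1\pmod 4$ and $\frac{k+3}{2}+k$ if $k\equiv 3\pmod 4$, and $\mathrm{X}(k)=T_1(k,r^*,1)$. The generalized Petersen graph $\mathrm{GP}(n,t)$ has vertices $a_i,b_i$ ($i\in\mathbb{Z}_n$) and edges $a_ia_{i+1}$, $a_ib_i$, $b_ib_{i+t}$.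
   Formalization: The parameter k+(-1)^α is corrected to k-(-1)^α: as printed it is divisible by 3, so GP(3k,k+(-1)^α) is not vertex-transitive (e.g. k=11 gives GP(33,12), and 12^2≡12 mod 33), whereas X(k) is. *)

theory Defs
  imports
    "HOL-Algebra.Group_Action"
    "HOL-Algebra.Elementary_Groups"
    "Graph_Theory.Graph_Theory"
begin

text \<open>
  A finite simple graph is a \<^term>\<open>pair_graph\<close>: an undirected edge is a pair of
  opposite arcs, so the valency of a vertex is its out-degree, and \<^term>\<open>digraph_iso\<close> is
  graph isomorphism.
\<close>

definition cubic :: "'a pair_pre_digraph \<Rightarrow> bool" where
  "cubic \<Gamma> \<longleftrightarrow> connected \<Gamma> \<and> (\<forall>v\<in>pverts \<Gamma>. out_degree \<Gamma> v = 3)"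

definition aut_group :: "'a pair_pre_digraph \<Rightarrow> ('a \<Rightarrow> 'a) monoid" where
  "aut_group \<Gamma> = (BijGroup (pverts \<Gamma>))
     \<lparr>carrier := {f \<in> Bij (pverts \<Gamma>).
        \<forall>x\<in>pverts \<Gamma>. \<forall>y\<in>pverts \<Gamma>. (f x, f y) \<in> parcs \<Gamma> \<longleftrightarrow> (x, y) \<in> parcs \<Gamma>}\<rparr>"

lemma subgroup_aut_group: "subgroup (carrier (aut_group \<Gamma>)) (BijGroup (pverts \<Gamma>))"
proof
  show "carrier (aut_group \<Gamma>) \<subseteq> carrier (BijGroup (pverts \<Gamma>))"
    by (auto simp: aut_group_def BijGroup_def)
  show "\<one>\<^bsub>BijGroup (pverts \<Gamma>)\<^esub> \<in> carrier (aut_group \<Gamma>)"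
    by (auto simp: aut_group_def BijGroup_def id_Bij)
next
  fix f g
  assume fg: "f \<in> carrier (aut_group \<Gamma>)" "g \<in> carrier (aut_group \<Gamma>)"
  then have B: "f \<in> Bij (pverts \<Gamma>)" "g \<in> Bij (pverts \<Gamma>)"
    by (auto simp: aut_group_def)
  have "g x \<in> pverts \<Gamma>" if "x \<in> pverts \<Gamma>" for x
    using Bij_imp_funcset[OF B(2)] that by auto
  with fg B show "f \<otimes>\<^bsub>BijGroup (pverts \<Gamma>)\<^esub> g \<in> carrier (aut_group \<Gamma>)"
    by (auto simp: aut_group_def BijGroup_def compose_Bij compose_eq)
next
  fix f
  assume f: "f \<in> carrier (aut_group \<Gamma>)"
  then have B: "f \<in> Bij (pverts \<Gamma>)"
    by (auto simp: aut_group_def)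
  let ?g = "inv_into (pverts \<Gamma>) f"
  have g: "?g x \<in> pverts \<Gamma>" "f (?g x) = x" if "x \<in> pverts \<Gamma>" for x
    using Bij_inv_into_mem[OF B that] B that
    by (auto simp: Bij_def bij_betw_inv_into_right)
  have "(?g x, ?g y) \<in> parcs \<Gamma> \<longleftrightarrow> (x, y) \<in> parcs \<Gamma>"
    if "x \<in> pverts \<Gamma>" "y \<in> pverts \<Gamma>" for x y
    using f g that by (auto simp: aut_group_def) (metis g)+
  with B show "inv\<^bsub>BijGroup (pverts \<Gamma>)\<^esub> f \<in> carrier (aut_group \<Gamma>)"
    by (auto simp: aut_group_def inv_BijGroup restrict_inv_into_Bij)
qed

lemma group_action_aut_group: "group_action (aut_group \<Gamma>) (pverts \<Gamma>) (\<lambda>f. f)"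
proof -
  have eq: "aut_group \<Gamma> = (BijGroup (pverts \<Gamma>))\<lparr>carrier := carrier (aut_group \<Gamma>)\<rparr>"
    by (simp add: aut_group_def)
  have "group (aut_group \<Gamma>)"
    using group.subgroup_imp_group[OF group_BijGroup subgroup_aut_group] eq by metis
  moreover have "(\<lambda>f. f) \<in> hom (aut_group \<Gamma>) (BijGroup (pverts \<Gamma>))"
    by (auto simp: hom_def aut_group_def BijGroup_def)
  ultimately show ?thesis
    by (simp add: group_action_def group_hom_def group_hom_axioms_def group_BijGroup)
qed

definition vertex_transitive :: "'a pair_pre_digraph \<Rightarrow> bool" where
  "vertex_transitive \<Gamma> \<longleftrightarrow> transitive_action (aut_group \<Gamma>) (pverts \<Gamma>) (\<lambda>f. f)"

definition multicirculant :: "nat \<Rightarrow> 'a pair_pre_digraph \<Rightarrow> bool" where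
  "multicirculant m \<Gamma> \<longleftrightarrow> connected \<Gamma> \<and>
     (\<exists>H. subgroup H (aut_group \<Gamma>) \<and>
        cyclic_group ((aut_group \<Gamma>)\<lparr>carrier := H\<rparr>) \<and>
        card (orbits ((aut_group \<Gamma>)\<lparr>carrier := H\<rparr>) (pverts \<Gamma>) (\<lambda>f. f)) = m \<and>
        (\<exists>n>1. \<forall>B\<in>orbits ((aut_group \<Gamma>)\<lparr>carrier := H\<rparr>) (pverts \<Gamma>) (\<lambda>f. f). card B = n))"

abbreviation bicirculant :: "'a pair_pre_digraph \<Rightarrow> bool" where
  "bicirculant \<equiv> multicirculant 2"

abbreviation tricirculant :: "'a pair_pre_digraph \<Rightarrow> bool" where
  "tricirculant \<equiv> multicirculant 3"

text \<open>
  Elements of the integers modulo \<open>n\<close> are represented by the integers in \<open>{0..<n}\<close>.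
\<close>

datatype t1_vertex = vert_u int | vert_v int | vert_w int

definition T1 :: "nat \<Rightarrow> int \<Rightarrow> int \<Rightarrow> t1_vertex pair_pre_digraph" where
  "T1 k r s = (let n = 2 * int k; Z = {0..<n} in mk_symmetric (with_proj
     \<lparr>pverts = vert_u ` Z \<union> vert_v ` Z \<union> vert_w ` Z,
      parcs = (\<Union>i\<in>Z. {(vert_u i, vert_u ((i + int k) mod n)),
                       (vert_u i, vert_v i),
                       (vert_u i, vert_w i),
                       (vert_v i, vert_w ((i + r) mod n)),
                       (vert_v i, vert_w ((i + s) mod n))})\<rparr>))"

definition type1 :: "'a pair_pre_digraph \<Rightarrow> bool" where
  "type1 \<Gamma> \<longleftrightarrow>
     (\<exists>k>0. \<exists>r\<in>{0..<2 * int k}. \<exists>s\<in>{0..<2 * int k}. digraph_iso \<Gamma> (T1 k r s))"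

text \<open>The parameter \<open>r\<^sup>*\<close> and the graph \<open>X(k)\<close> are only meaningful for odd \<open>k\<close>.\<close>

definition r_star :: "nat \<Rightarrow> int" where
  "r_star k =
     (if k mod 4 = 1 then (int k + 3) div 2 else (int k + 3) div 2 + int k) mod (2 * int k)"

definition X_graph :: "nat \<Rightarrow> t1_vertex pair_pre_digraph" where
  "X_graph k = T1 k (r_star k) 1"

datatype gp_vertex = vert_a int | vert_b int

text \<open>
  A sign to be careful with: for \<open>3 \<nmid> k\<close> the vertex-transitive member of the pair
  \<open>GP(3k, k - 1)\<close>, \<open>GP(3k, k + 1)\<close> is the one whose parameter is not divisible by 3, as
  vertex-transitivity of \<open>GP(n, t)\<close> forces \<open>t\<^sup>2 \<equiv> \<plusminus>1\<close> modulo \<open>n\<close> (except for \<open>GP(10, 2)\<close>).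
  So \<open>X(k)\<close> can only be \<open>GP(3k, k + 1)\<close> if \<open>k \<equiv> 1\<close> and \<open>GP(3k, k - 1)\<close> if \<open>k \<equiv> 2\<close> modulo 3.
  With \<open>\<alpha> \<in> {1, 2}\<close> and \<open>\<alpha> \<equiv> k\<close> modulo 3 the parameter is therefore \<open>k - (-1)\<^sup>\<alpha>\<close>;
  \<open>k + (-1)\<^sup>\<alpha>\<close> is the other member of the pair, which is not vertex-transitive.
\<close>

definition GP :: "nat \<Rightarrow> int \<Rightarrow> gp_vertex pair_pre_digraph" where
  "GP n t = (let Z = {0..<int n} in mk_symmetric (with_proj
     \<lparr>pverts = vert_a ` Z \<union> vert_b ` Z,
      parcs = (\<Union>i\<in>Z. {(vert_a i, vert_a ((i + 1) mod int n)),
                       (vert_a i, vert_b i),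
                       (vert_b i, vert_b ((i + t) mod int n))})\<rparr>))"

end

theory Submission
  imports Defs
begin

text \<open>
  Counts of closed non-backtracking walks of a fixed length through an arc are invariant under
  automorphisms. In \<open>T1 k r s\<close> a walk of given type is closed iff a linear form
  \<open>a r + b s + c k\<close> vanishes modulo \<open>2k\<close>, so equating the counts at \<open>u\<^sub>0\<close> and \<open>v\<^sub>0\<close> for the lengths
  4, 7 and 8 gives equations between the truth values of such congruences. As \<open>k \<ge> 9\<close> and the graph
  is connected, they leave, up to exchanging \<open>r\<close> and \<open>s\<close>, only \<open>s = 3r\<close> and \<open>2r = 3s + k\<close>.

  In both cases no further short relation holds, and the number of 8-cycles through an edge singles
  out the perfect matching of the edges \<open>u\<^sub>i u\<^bsub>i+k\<^esub>\<close>, \<open>v\<^sub>i w\<^bsub>i+s\<^esub>\<close>; automorphisms therefore also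
  preserve the complementary 2-factor. If \<open>s = 3r\<close>, the mate of a vertex \<open>w\<close> lies seven steps away on
  its path in the 2-factor, but that of a vertex \<open>u\<close> does not. If \<open>2r = 3s + k\<close> and \<open>r\<close> is odd, the
  mate of \<open>u\<close> lies \<open>3k\<close> steps away, but that of \<open>v\<close> does not. If \<open>r\<close> is even, then \<open>k\<close> is odd
  and \<open>s\<close> is a unit, and multiplication by its inverse gives \<open>X(k)\<close>.

  Conversely, in \<open>X(k)\<close> the paths of the 2-factor have indices of constant parity; moving the even ones
  forward and the odd ones backward by one step is an automorphism that fuses the three orbits of the
  translations. If \<open>3\<close> does not divide \<open>k\<close>, there are just two such paths, the two rims of a
  generalized Petersen graph.
\<close>

section \<open>Isomorphisms of simple graphs\<close>

definition nbrs :: "'a pair_pre_digraph \<Rightarrow> 'a \<Rightarrow> 'a set" where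
  "nbrs G x = {y. (x, y) \<in> parcs G}"

text \<open>A vertex map alone: in a simple graph it determines the arc map that
  \<open>digraph_iso\<close> carries along. Its values outside the vertex set are left free, whereas
  the elements of \<open>aut_group\<close> are extensional.\<close>

definition pair_iso :: "('a \<Rightarrow> 'b) \<Rightarrow> 'a pair_pre_digraph \<Rightarrow> 'b pair_pre_digraph \<Rightarrow> bool" where
  "pair_iso h G H \<longleftrightarrow> bij_betw h (pverts G) (pverts H) \<and>
     (\<forall>x\<in>pverts G. \<forall>y\<in>pverts G. (h x, h y) \<in> parcs H \<longleftrightarrow> (x, y) \<in> parcs G)"

lemma nbrs_subset: "pair_wf_digraph G \<Longrightarrow> nbrs G x \<subseteq> pverts G"
  by (auto simp: nbrs_def dest: pair_wf_digraph.in_arcsD2)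

lemma out_degree_eq_card_nbrs: "out_degree (with_proj G) x = card (nbrs G x)"
proof -
  have "out_arcs (with_proj G) x = Pair x ` nbrs G x"
    by (auto simp: out_arcs_def nbrs_def)
  then show ?thesis
    by (simp add: out_degree_def card_image inj_on_def)
qed

lemma pair_iso_mem: "pair_iso h G H \<Longrightarrow> x \<in> pverts G \<Longrightarrow> h x \<in> pverts H"
  by (auto simp: pair_iso_def bij_betw_def)

lemma pair_iso_inj: "pair_iso h G H \<Longrightarrow> inj_on h (pverts G)"
  by (auto simp: pair_iso_def bij_betw_def)

lemma pair_iso_comp:
  assumes "pair_iso h G H" "pair_iso h' H K"
  shows "pair_iso (h' \<circ> h) G K"
  using assms pair_iso_mem[OF assms(1)] unfolding pair_iso_def
  by (auto intro: bij_betw_trans)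

lemma pair_iso_inv_into:
  assumes "pair_iso h G H"
  shows "pair_iso (inv_into (pverts G) h) H G"
proof -
  have b: "bij_betw h (pverts G) (pverts H)" using assms by (simp add: pair_iso_def)
  let ?g = "inv_into (pverts G) h"
  have "?g x \<in> pverts G" "h (?g x) = x" if "x \<in> pverts H" for x
    using b that by (auto simp: bij_betw_def inv_into_into f_inv_into_f)
  then show ?thesis
    using assms b bij_betw_inv_into[OF b] unfolding pair_iso_def by metis
qed

lemma nbrs_pair_iso:
  assumes "pair_wf_digraph G" "pair_wf_digraph H" "pair_iso h G H" "x \<in> pverts G"
  shows "nbrs H (h x) = h ` nbrs G x"
proof -
  have im: "h ` pverts G = pverts H" using assms(3) by (auto simp: pair_iso_def bij_betw_def)
  show ?thesis
  proof
    show "h ` nbrs G x \<subseteq> nbrs H (h x)"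
      using assms nbrs_subset[OF assms(1)] by (auto simp: nbrs_def pair_iso_def)
    show "nbrs H (h x) \<subseteq> h ` nbrs G x"
    proof
      fix z assume z: "z \<in> nbrs H (h x)"
      then obtain y where "y \<in> pverts G" "z = h y"
        using nbrs_subset[OF assms(2)] im by (metis imageE subsetD)
      then show "z \<in> h ` nbrs G x"
        using z assms by (auto simp: nbrs_def pair_iso_def)
    qed
  qed
qed

lemma pair_isoI_nbrs:
  assumes "pair_wf_digraph G" "bij_betw h (pverts G) (pverts H)"
    "\<And>x. x \<in> pverts G \<Longrightarrow> nbrs H (h x) = h ` nbrs G x"
  shows "pair_iso h G H"
  unfolding pair_iso_def
proof (intro conjI ballI)
  fix x y assume xy: "x \<in> pverts G" "y \<in> pverts G"
  have "(h x, h y) \<in> parcs H \<longleftrightarrow> h y \<in> h ` nbrs G x"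
    using assms(3)[OF xy(1)] by (auto simp: nbrs_def)
  also have "\<dots> \<longleftrightarrow> y \<in> nbrs G x"
    using assms(2) xy nbrs_subset[OF assms(1)] by (metis bij_betw_def inj_on_image_mem_iff)
  finally show "(h x, h y) \<in> parcs H \<longleftrightarrow> (x, y) \<in> parcs G" by (simp add: nbrs_def)
qed (fact assms(2))

lemma digraph_iso_if_pair_iso:
  assumes "pair_wf_digraph G" "pair_wf_digraph H" "pair_iso h G H"
  shows "digraph_iso (with_proj G) (with_proj H)"
proof -
  let ?f = "\<lparr>iso_verts = h, iso_arcs = map_prod h h, iso_head = snd, iso_tail = fst\<rparr>"
  have bij: "bij_betw h (pverts G) (pverts H)" and
    iff: "\<And>x y. x \<in> pverts G \<Longrightarrow> y \<in> pverts G \<Longrightarrow> (h x, h y) \<in> parcs H \<longleftrightarrow> (x, y) \<in> parcs G"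
    using assms(3) by (auto simp: pair_iso_def)
  have G: "parcs G \<subseteq> pverts G \<times> pverts G" and H: "parcs H \<subseteq> pverts H \<times> pverts H"
    using assms(1,2) by (auto dest: pair_wf_digraph.in_arcsD1 pair_wf_digraph.in_arcsD2)
  have inj: "inj_on (map_prod h h) (parcs G)"
    using bij G by (auto simp: inj_on_def bij_betw_def) blast+
  have "pre_digraph.digraph_isomorphism (with_proj G) ?f"
    using assms(1) bij inj by (auto simp: pre_digraph.digraph_isomorphism_def wf_digraph_wp_iff bij_betw_def)
  moreover have "map_prod h h ` parcs G = parcs H"
  proof
    show "map_prod h h ` parcs G \<subseteq> parcs H" using G iff by auto
    show "parcs H \<subseteq> map_prod h h ` parcs G"
    proof
      fix e assume e: "e \<in> parcs H"
      then obtain x y where "x \<in> pverts G" "y \<in> pverts G" "e = (h x, h y)"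
        using H bij by (auto simp: bij_betw_def) blast
      then show "e \<in> map_prod h h ` parcs G" using iff e by (auto intro!: image_eqI[of _ _ "(x, y)"])
    qed
  qed
  then have "with_proj H = app_iso ?f (with_proj G)"
    using bij by (auto simp: app_iso_def with_proj_def bij_betw_def)
  ultimately show ?thesis unfolding digraph_iso_def by blast
qed

text \<open>The target is the image of \<open>G\<close>, and its tail and head functions are
  \<open>fst\<close> and \<open>snd\<close>; this forces the arc map to be the one induced by the
  vertex map, and well-formedness passes to the target.\<close>

lemma digraph_iso_pair_isoE:
  assumes "pair_wf_digraph G" "digraph_iso (with_proj G) (with_proj H)"
  obtains h where "pair_iso h G H" "pair_wf_digraph H"
proof -
  obtain f where f: "pre_digraph.digraph_isomorphism (with_proj G) f"
    and H: "with_proj H = app_iso f (with_proj G)"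
    using assms(2) by (auto simp: digraph_iso_def)
  have G: "parcs G \<subseteq> pverts G \<times> pverts G"
    using assms(1) by (auto dest: pair_wf_digraph.in_arcsD1 pair_wf_digraph.in_arcsD2)
  let ?h = "iso_verts f"
  have eqs: "pverts H = ?h ` pverts G" "parcs H = iso_arcs f ` parcs G" "iso_tail f = fst" "iso_head f = snd"
    using H by (auto simp: app_iso_def with_proj_def)
  have inj: "inj_on ?h (pverts G)" using f by (auto simp: pre_digraph.digraph_isomorphism_def)
  have arc: "iso_arcs f a = (?h (fst a), ?h (snd a))" if "a \<in> parcs G" for a
    using f that by (auto simp: pre_digraph.digraph_isomorphism_def eqs prod_eq_iff)
  then have arcs: "parcs H = (\<lambda>a. (?h (fst a), ?h (snd a))) ` parcs G"
    by (auto simp: eqs)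
  have "pair_iso ?h G H"
    unfolding pair_iso_def arcs eqs(1)
  proof (intro conjI ballI inj_on_imp_bij_betw inj)
    fix x y assume xy: "x \<in> pverts G" "y \<in> pverts G"
    have "(x, y) \<in> parcs G" if a: "a \<in> parcs G" "(?h x, ?h y) = (?h (fst a), ?h (snd a))" for a
    proof -
      have "fst a \<in> pverts G" "snd a \<in> pverts G" using a(1) G by auto
      then have "x = fst a" "y = snd a" using a(2) inj xy by (auto dest: inj_onD)
      then show ?thesis using a(1) by simp
    qed
    then show "(?h x, ?h y) \<in> (\<lambda>a. (?h (fst a), ?h (snd a))) ` parcs G \<longleftrightarrow> (x, y) \<in> parcs G"
      by (force intro: image_eqI[of _ _ "(x, y)"])
  qed
  moreover have "pair_wf_digraph H"
    using G by unfold_locales (auto simp: arcs eqs(1))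
  ultimately show ?thesis using that by blast
qed

section \<open>Automorphisms, vertex-transitivity and connectedness\<close>

lemma carrier_aut_group_pair_iso: "f \<in> carrier (aut_group G) \<Longrightarrow> pair_iso f G G"
  by (simp add: aut_group_def Bij_def pair_iso_def)

lemma restrict_pair_iso_in_aut_group:
  "pair_iso f G G \<Longrightarrow> restrict f (pverts G) \<in> carrier (aut_group G)"
  by (simp add: aut_group_def Bij_def pair_iso_def bij_betw_restrict_eq)

lemma vertex_transitive_iff:
  "vertex_transitive G \<longleftrightarrow> (\<forall>x\<in>pverts G. \<forall>y\<in>pverts G. \<exists>f. pair_iso f G G \<and> f x = y)"
proof
  assume "vertex_transitive G"
  then show "\<forall>x\<in>pverts G. \<forall>y\<in>pverts G. \<exists>f. pair_iso f G G \<and> f x = y"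
    using transitive_action.unique_orbit[of "aut_group G" "pverts G" "\<lambda>f. f"]
      carrier_aut_group_pair_iso
    unfolding vertex_transitive_def by blast
next
  assume R: "\<forall>x\<in>pverts G. \<forall>y\<in>pverts G. \<exists>f. pair_iso f G G \<and> f x = y"
  have "\<exists>g\<in>carrier (aut_group G). g x = y" if xy: "x \<in> pverts G" "y \<in> pverts G" for x y
  proof -
    obtain f where f: "pair_iso f G G" "f x = y" using R xy by blast
    then have "restrict f (pverts G) \<in> carrier (aut_group G)"
      by (intro restrict_pair_iso_in_aut_group)
    with f xy show ?thesis by (intro bexI[of _ "restrict f (pverts G)"]) auto
  qed
  then show "vertex_transitive G"
    unfolding vertex_transitive_def transitive_action_def transitive_action_axioms_def
    using group_action_aut_group by blast
qed

text \<open>Automorphisms of \<open>H\<close> are conjugated back to \<open>G\<close> by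
  \<open>h\<close>.\<close>

lemma vertex_transitive_pair_iso:
  assumes "pair_iso h G H" "vertex_transitive H"
  shows "vertex_transitive G"
  unfolding vertex_transitive_iff
proof (intro ballI)
  fix x y assume xy: "x \<in> pverts G" "y \<in> pverts G"
  then obtain f where f: "pair_iso f H H" "f (h x) = h y"
    using assms pair_iso_mem[OF assms(1)] unfolding vertex_transitive_iff by blast
  let ?g = "inv_into (pverts G) h"
  have "pair_iso (?g \<circ> (f \<circ> h)) G G"
    by (rule pair_iso_comp[OF pair_iso_comp[OF assms(1) f(1)] pair_iso_inv_into[OF assms(1)]])
  moreover have "(?g \<circ> (f \<circ> h)) x = y"
    using f xy pair_iso_inj[OF assms(1)] by simp
  ultimately show "\<exists>f. pair_iso f G G \<and> f x = y" by blast
qed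

text \<open>The form in which connectedness is exploited later: to bound the common divisors of
  \<open>k\<close>, \<open>r\<close>, \<open>s\<close>, and to prove that a map into
  \<open>T1\<close> is surjective.\<close>

lemma connected_closed_subset:
  assumes "connected (with_proj G)" "x \<in> S" "x \<in> pverts G"
    and closed: "\<And>x y. (x, y) \<in> parcs G \<Longrightarrow> x \<in> S \<longleftrightarrow> y \<in> S"
  shows "pverts G \<subseteq> S"
proof
  fix y assume y: "y \<in> pverts G"
  have "x \<rightarrow>\<^sup>*\<^bsub>with_proj (mk_symmetric (with_proj G))\<^esub> y"
    using assms y by (auto simp: connected_def strongly_connected_def mk_symmetric_def)
  then have "(x, y) \<in> (parcs (mk_symmetric (with_proj G)))\<^sup>*"
    by (auto dest: reachable_rtranclI)
  then show "y \<in> S"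
    using assms(2) by induction (use closed in \<open>auto simp: mk_symmetric_def\<close>)
qed

lemma connected_digraph_iso:
  assumes "pair_wf_digraph G" "connected (with_proj G)" "digraph_iso (with_proj G) H"
  shows "connected H"
  using assms wf_digraph.connectedI_app_iso[of "with_proj G"]
  by (auto simp: digraph_iso_def wf_digraph_wp_iff)

section \<open>The graphs \<open>T1\<close>\<close>

datatype vtype = TU | TV | TW

text \<open>Every integer is allowed as an index, so that index arithmetic takes place in the
  integers and equality of vertices becomes divisibility by \<open>2 * int k\<close>.\<close>

fun vtx :: "nat \<Rightarrow> vtype \<Rightarrow> int \<Rightarrow> t1_vertex" where
  "vtx k TU i = vert_u (i mod (2 * int k))"
| "vtx k TV i = vert_v (i mod (2 * int k))"
| "vtx k TW i = vert_w (i mod (2 * int k))"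

lemma vtx_eq_iff: "vtx k t i = vtx k t' j \<longleftrightarrow> t = t' \<and> 2 * int k dvd i - j"
  by (cases t; cases t') (auto simp: mod_eq_dvd_iff)

lemma vtx_eqI: "2 * int k dvd i - j \<Longrightarrow> vtx k t i = vtx k t j"
  by (simp add: vtx_eq_iff)

lemma pverts_T1:
  assumes "k > 0"
  shows "pverts (T1 k r s) = range (\<lambda>(t, i). vtx k t i)"
proof
  show "pverts (T1 k r s) \<subseteq> range (\<lambda>(t, i). vtx k t i)"
  proof
    fix x assume "x \<in> pverts (T1 k r s)"
    then obtain i where "x = vert_u i \<or> x = vert_v i \<or> x = vert_w i" "0 \<le> i" "i < 2 * int k"
      by (auto simp: T1_def Let_def)
    then have "x = vtx k TU i \<or> x = vtx k TV i \<or> x = vtx k TW i" by simp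
    then show "x \<in> range (\<lambda>(t, i). vtx k t i)"
      by (metis (mono_tags, lifting) case_prod_conv rangeI)
  qed
  show "range (\<lambda>(t, i). vtx k t i) \<subseteq> pverts (T1 k r s)"
  proof safe
    fix t i show "vtx k t i \<in> pverts (T1 k r s)"
      using assms by (cases t) (auto simp: T1_def Let_def)
  qed
qed

declare vtx.simps [simp del]

lemma vtx_in_T1: "k > 0 \<Longrightarrow> vtx k t i \<in> pverts (T1 k r s)"
  by (auto simp: pverts_T1)

lemma T1_vertexE:
  assumes "x \<in> pverts (T1 k r s)" "k > 0"
  obtains t i where "x = vtx k t i"
  using assms by (auto simp: pverts_T1)

lemma card_pverts_T1: "card (pverts (T1 k r s)) = 6 * k"
proof -
  let ?Z = "{0..<2 * int k}"
  have "pverts (T1 k r s) = vert_u ` ?Z \<union> vert_v ` ?Z \<union> vert_w ` ?Z"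
    by (simp add: T1_def Let_def)
  also have "card \<dots> = card (vert_u ` ?Z \<union> vert_v ` ?Z) + card (vert_w ` ?Z)"
    by (rule card_Un_disjoint) auto
  also have "card (vert_u ` ?Z \<union> vert_v ` ?Z) = card (vert_u ` ?Z) + card (vert_v ` ?Z)"
    by (rule card_Un_disjoint) auto
  finally show ?thesis by (simp add: card_image inj_on_def)
qed

lemma range_mod_int:
  fixes n :: int
  assumes "n > 0"
  shows "range (\<lambda>i. i mod n) = {0..<n}"
proof (intro equalityI subsetI)
  fix x assume "x \<in> {0..<n}"
  then have "x = x mod n" by simp
  then show "x \<in> range (\<lambda>i. i mod n)" by (rule range_eqI)
qed (use assms in auto)

definition T1_edges :: "nat \<Rightarrow> int \<Rightarrow> int \<Rightarrow> (t1_vertex \<times> t1_vertex) set" where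
  "T1_edges k r s = (\<Union>i. {(vtx k TU i, vtx k TU (i + int k)), (vtx k TU i, vtx k TV i),
     (vtx k TU i, vtx k TW i), (vtx k TV i, vtx k TW (i + r)), (vtx k TV i, vtx k TW (i + s))})"

lemma parcs_T1:
  assumes "k > 0"
  shows "parcs (T1 k r s) = T1_edges k r s \<union> (T1_edges k r s)\<inverse>"
proof -
  let ?n = "2 * int k"
  let ?e = "\<lambda>i. {(vert_u i, vert_u ((i + int k) mod ?n)), (vert_u i, vert_v i), (vert_u i, vert_w i),
                 (vert_v i, vert_w ((i + r) mod ?n)), (vert_v i, vert_w ((i + s) mod ?n))}"
  have "T1_edges k r s = (\<Union>i. ?e (i mod ?n))"
    by (simp add: T1_edges_def mod_add_left_eq vtx.simps)
  also have "\<dots> = (\<Union>i\<in>{0..<?n}. ?e i)"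
    using range_mod_int[of ?n] assms by (metis (no_types, lifting) SUP_cong image_image of_nat_0_less_iff zero_less_mult_iff zero_less_numeral)
  finally show ?thesis
    by (auto simp: T1_def Let_def mk_symmetric_def)
qed

lemma pair_wf_T1: "k > 0 \<Longrightarrow> pair_wf_digraph (T1 k r s)"
  by unfold_locales (auto simp: parcs_T1 T1_edges_def vtx_in_T1)

lemma T1_swap: "k > 0 \<Longrightarrow> T1 k r s = T1 k s r"
  by (rule pair_pre_digraph.equality) (auto simp: pverts_T1 parcs_T1 T1_edges_def)

lemma nbrs_T1_iff:
  assumes "k > 0"
  shows "vtx k t' j \<in> nbrs (T1 k r s) (vtx k t i) \<longleftrightarrow>
    (case (t, t') of
      (TU, TU) \<Rightarrow> 2 * int k dvd j - i - int k
    | (TV, TW) \<Rightarrow> 2 * int k dvd j - i - r \<or> 2 * int k dvd j - i - s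
    | (TW, TV) \<Rightarrow> 2 * int k dvd j - i + r \<or> 2 * int k dvd j - i + s
    | _ \<Rightarrow> t \<noteq> t' \<and> 2 * int k dvd j - i)" (is "_ \<longleftrightarrow> ?R")
proof -
  let ?n = "2 * int k"
  have e: "(vtx k t i, vtx k t' j) \<in> T1_edges k r s \<longleftrightarrow>
    (case (t, t') of
      (TU, TU) \<Rightarrow> ?n dvd j - i - int k
    | (TV, TW) \<Rightarrow> ?n dvd j - i - r \<or> ?n dvd j - i - s
    | (TU, _) \<Rightarrow> ?n dvd j - i | _ \<Rightarrow> False)" for t i t' j
  proof -
    have 1: "(\<exists>l. vtx k t i = vtx k a l \<and> vtx k t' j = vtx k b (l + d)) \<longleftrightarrow>
      t = a \<and> t' = b \<and> ?n dvd j - i - d" for a b d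
    proof
      assume "\<exists>l. vtx k t i = vtx k a l \<and> vtx k t' j = vtx k b (l + d)"
      then obtain l where l: "t = a" "t' = b" "?n dvd i - l" "?n dvd j - (l + d)"
        by (auto simp: vtx_eq_iff)
      have "j - i - d = (j - (l + d)) - (i - l)" by simp
      then have "?n dvd j - i - d" using dvd_diff[OF l(4,3)] by presburger
      then show "t = a \<and> t' = b \<and> ?n dvd j - i - d" using l by blast
    next
      assume "t = a \<and> t' = b \<and> ?n dvd j - i - d"
      then show "\<exists>l. vtx k t i = vtx k a l \<and> vtx k t' j = vtx k b (l + d)"
        by (intro exI[of _ i]) (simp add: vtx_eq_iff algebra_simps)
    qed
    show ?thesis
      using 1[of TU TU "int k"] 1[of TU TV 0] 1[of TU TW 0] 1[of TV TW r] 1[of TV TW s]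
      by (cases t; cases t') (auto simp: T1_edges_def)
  qed
  \<comment> \<open>The edges between \<open>u_i\<close> and \<open>u_(i+k)\<close> are symmetric
    because \<open>k\<close> and \<open>- k\<close> agree modulo \<open>2k\<close>.\<close>
  have s: "?n dvd i - j - int k \<longleftrightarrow> ?n dvd j - i - int k"
  proof -
    have "i - j - int k = - (j - i - int k) - ?n" by simp
    then show ?thesis by (metis dvd_minus_iff dvd_diff_left_iff dvd_refl)
  qed
  have m: "?n dvd i - j - d \<longleftrightarrow> ?n dvd j - i + d" for d
    using dvd_minus_iff[of ?n "j - i + d"] by (simp add: algebra_simps)
  show ?thesis
    using e[of t i t' j] e[of t' j t i] s m[of r] m[of s] m[of 0] assms
    by (cases t; cases t') (auto simp: nbrs_def parcs_T1)
qed

lemma nbrs_T1: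
  assumes "k > 0"
  shows "nbrs (T1 k r s) (vtx k TU i) = {vtx k TU (i + int k), vtx k TV i, vtx k TW i}"
    and "nbrs (T1 k r s) (vtx k TV i) = {vtx k TU i, vtx k TW (i + r), vtx k TW (i + s)}"
    and "nbrs (T1 k r s) (vtx k TW i) = {vtx k TU i, vtx k TV (i - r), vtx k TV (i - s)}"
proof -
  have *: "nbrs (T1 k r s) (vtx k t i) = X" if X: "\<And>x. x \<in> X \<Longrightarrow> \<exists>t j. x = vtx k t j"
    and eq: "\<And>t' j. vtx k t' j \<in> nbrs (T1 k r s) (vtx k t i) \<longleftrightarrow> vtx k t' j \<in> X" for t X
  proof (intro equalityI subsetI)
    fix x assume x: "x \<in> nbrs (T1 k r s) (vtx k t i)"
    then have "x \<in> pverts (T1 k r s)" using nbrs_subset[OF pair_wf_T1[OF assms]] by blast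
    then obtain t' j where "x = vtx k t' j" using assms by (rule T1_vertexE)
    then show "x \<in> X" using x eq by simp
  next
    fix x assume x: "x \<in> X"
    then obtain t' j where "x = vtx k t' j" using X by blast
    then show "x \<in> nbrs (T1 k r s) (vtx k t i)" using x eq by simp
  qed
  note simps = nbrs_T1_iff[OF assms] vtx_eq_iff diff_diff_eq diff_diff_eq2 diff_add_eq insert_iff empty_iff
  show "nbrs (T1 k r s) (vtx k TU i) = {vtx k TU (i + int k), vtx k TV i, vtx k TW i}"
  proof (rule *)
    fix t' j show "vtx k t' j \<in> nbrs (T1 k r s) (vtx k TU i) \<longleftrightarrow> vtx k t' j \<in> {vtx k TU (i + int k), vtx k TV i, vtx k TW i}"
      by (cases t') (simp_all add: simps)
  qed blast
  show "nbrs (T1 k r s) (vtx k TV i) = {vtx k TU i, vtx k TW (i + r), vtx k TW (i + s)}"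
  proof (rule *)
    fix t' j show "vtx k t' j \<in> nbrs (T1 k r s) (vtx k TV i) \<longleftrightarrow> vtx k t' j \<in> {vtx k TU i, vtx k TW (i + r), vtx k TW (i + s)}"
      by (cases t') (simp_all add: simps)
  qed blast
  show "nbrs (T1 k r s) (vtx k TW i) = {vtx k TU i, vtx k TV (i - r), vtx k TV (i - s)}"
  proof (rule *)
    fix t' j show "vtx k t' j \<in> nbrs (T1 k r s) (vtx k TW i) \<longleftrightarrow> vtx k t' j \<in> {vtx k TU i, vtx k TV (i - r), vtx k TV (i - s)}"
      by (cases t') (simp_all add: simps)
  qed blast
qed

text \<open>As \<open>d\<close> divides \<open>2k\<close>, divisibility of an index by
  \<open>d\<close> is well defined. No edge changes it, so by connectedness it passes from
  \<open>u_0\<close> to \<open>u_1\<close>.\<close>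

lemma T1_connected_common_divisor:
  assumes "k > 0" "connected (with_proj (T1 k r s))" "d dvd int k" "d dvd r" "d dvd s"
  shows "d dvd 1"
proof -
  define S where "S = {vtx k t i | t i. d dvd i}"
  have mem: "vtx k t i \<in> S \<longleftrightarrow> d dvd i" for t i
  proof
    assume "vtx k t i \<in> S"
    then obtain j where j: "d dvd j" "2 * int k dvd i - j" by (auto simp: vtx_eq_iff S_def)
    have "d dvd 2 * int k" using assms(3) by simp
    then have "d dvd (i - j) + j" using j by (meson dvd_add dvd_trans)
    then show "d dvd i" by simp
  qed (auto simp: S_def)
  have "x \<in> S \<longleftrightarrow> y \<in> S" if "(x, y) \<in> T1_edges k r s" for x y
    using that assms(3-5) by (auto simp: T1_edges_def mem dvd_add_left_iff)
  then have "pverts (T1 k r s) \<subseteq> S"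
    using assms(1,2) by (intro connected_closed_subset[of _ "vtx k TU 0"]) (auto simp: parcs_T1 vtx_in_T1 mem)
  then have "vtx k TU 1 \<in> S" using vtx_in_T1[OF assms(1)] by blast
  then show ?thesis using mem by blast
qed

section \<open>Counting closed non-backtracking walks\<close>

text \<open>
  Here \<open>(x, y)\<close> is the first arc of the walk and \<open>(p, c)\<close> the one just traversed; the condition
  \<open>p \<noteq> y\<close> at the end makes the closed walk non-backtracking also when read cyclically.
  Note that \<open>arc_count G m\<close> concerns closed walks of length \<open>m + 1\<close>.
\<close>

fun walks :: "('a \<Rightarrow> 'a set) \<Rightarrow> 'a \<Rightarrow> 'a \<Rightarrow> nat \<Rightarrow> 'a \<Rightarrow> 'a \<Rightarrow> nat" where
  "walks N x y 0 p c = (if c = x \<and> p \<noteq> y then 1 else 0)"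
| "walks N x y (Suc m) p c = (\<Sum>z\<in>N c - {p}. walks N x y m c z)"

definition arc_count :: "'a pair_pre_digraph \<Rightarrow> nat \<Rightarrow> 'a \<Rightarrow> 'a \<Rightarrow> nat" where
  "arc_count G m x y = walks (nbrs G) x y m x y"

lemma walks_pair_iso:
  assumes wf: "pair_wf_digraph G" "pair_wf_digraph H" and h: "pair_iso h G H"
    and "x \<in> pverts G" "y \<in> pverts G" "p \<in> pverts G" "c \<in> pverts G"
  shows "walks (nbrs H) (h x) (h y) m (h p) (h c) = walks (nbrs G) x y m p c"
  using assms(4-)
proof (induction m arbitrary: p c)
  case 0
  then show ?case using pair_iso_inj[OF h] by (auto dest: inj_onD)
next
  case (Suc m)
  have sub: "nbrs G c \<subseteq> pverts G" by (rule nbrs_subset[OF wf(1)])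
  have inj: "inj_on h (nbrs G c \<union> {p})"
    by (rule inj_on_subset[OF pair_iso_inj[OF h]]) (use sub Suc.prems in auto)
  have "nbrs H (h c) - {h p} = h ` (nbrs G c - {p})"
    using nbrs_pair_iso[OF wf h Suc.prems(4)] inj by (auto simp: inj_on_def)
  then have "walks (nbrs H) (h x) (h y) (Suc m) (h p) (h c)
      = (\<Sum>z\<in>h ` (nbrs G c - {p}). walks (nbrs H) (h x) (h y) m (h c) z)"
    by simp
  also have "\<dots> = (\<Sum>z\<in>nbrs G c - {p}. walks (nbrs H) (h x) (h y) m (h c) (h z))"
    by (rule sum.reindex_cong[OF inj_on_subset[OF inj]]) auto
  also have "\<dots> = (\<Sum>z\<in>nbrs G c - {p}. walks (nbrs G) x y m c z)"
    using sub Suc by (intro sum.cong refl) blast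
  finally show ?case by simp
qed

lemma arc_count_pair_iso:
  assumes "pair_wf_digraph G" "pair_wf_digraph H" "pair_iso h G H" "x \<in> pverts G" "y \<in> pverts G"
  shows "arc_count H m (h x) (h y) = arc_count G m x y"
  unfolding arc_count_def by (rule walks_pair_iso) (fact assms)+

text \<open>Summing over the arcs that leave a vertex turns the arc invariant into a vertex
  invariant.\<close>

lemma sum_arc_count_pair_iso:
  assumes wf: "pair_wf_digraph G" "pair_wf_digraph H" and h: "pair_iso h G H" and x: "x \<in> pverts G"
  shows "(\<Sum>z\<in>nbrs H (h x). arc_count H m (h x) z) = (\<Sum>z\<in>nbrs G x. arc_count G m x z)"
proof -
  have sub: "nbrs G x \<subseteq> pverts G" by (rule nbrs_subset[OF wf(1)])
  have "(\<Sum>z\<in>h ` nbrs G x. arc_count H m (h x) z) = (\<Sum>z\<in>nbrs G x. arc_count H m (h x) (h z))"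
    using inj_on_subset[OF pair_iso_inj[OF h] sub] by (rule sum.reindex_cong) auto
  also have "\<dots> = (\<Sum>z\<in>nbrs G x. arc_count G m x z)"
    using sub arc_count_pair_iso[OF wf h x] by (intro sum.cong) auto
  finally show ?thesis by (simp add: nbrs_pair_iso[OF wf h x])
qed

text \<open>
  The three arcs leaving a vertex of each type in \<open>T1 k r s\<close>: type of the target, label of the
  reverse arc there, and the coefficients of \<open>r\<close>, \<open>s\<close>, \<open>k\<close> in the increment of the index.
\<close>

fun steps :: "vtype \<Rightarrow> (vtype \<times> nat \<times> int \<times> int \<times> int) list" where
  "steps TU = [(TU, 0, 0, 0, 1), (TV, 0, 0, 0, 0), (TW, 0, 0, 0, 0)]"
| "steps TV = [(TU, 1, 0, 0, 0), (TW, 1, 1, 0, 0), (TW, 2, 0, 1, 0)]"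
| "steps TW = [(TU, 2, 0, 0, 0), (TV, 1, -1, 0, 0), (TV, 2, 0, -1, 0)]"

definition nbr :: "nat \<Rightarrow> int \<Rightarrow> int \<Rightarrow> vtype \<Rightarrow> nat \<Rightarrow> int \<Rightarrow> t1_vertex" where
  "nbr k r s t l i = (case steps t ! l of (t', _, a, b, c) \<Rightarrow> vtx k t' (i + a * r + b * s + c * int k))"

text \<open>Walks are enumerated in the quotient by the translations, which has one vertex per type;
  the result is therefore independent of \<open>k\<close>, \<open>r\<close>, \<open>s\<close>. The
  label \<open>l\<close> is that of the arc leading back, which the next step must avoid. The final
  test \<open>l \<noteq> l0\<close> is the cyclic non-backtracking condition
  \<open>p \<noteq> y\<close> of \<open>walks\<close>; whether the index returns as well is left to
  \<open>closing\<close>.\<close>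

fun voltages :: "vtype \<Rightarrow> nat \<Rightarrow> nat \<Rightarrow> vtype \<Rightarrow> nat \<Rightarrow> int \<Rightarrow> int \<Rightarrow> int \<Rightarrow> (int \<times> int \<times> int) list" where
  "voltages t0 l0 0 t l a b c = (if t = t0 \<and> l \<noteq> l0 then [(a, b, c)] else [])"
| "voltages t0 l0 (Suc m) t l a b c = concat (map (\<lambda>j. if j = l then [] else
     (case steps t ! j of (t', l', a', b', c') \<Rightarrow>
       voltages t0 l0 m t' l' (a + a') (b + b') (c + c'))) [0, 1, 2])"

definition start_voltages :: "vtype \<Rightarrow> nat \<Rightarrow> nat \<Rightarrow> (int \<times> int \<times> int) list" where
  "start_voltages t l m = (case steps t ! l of (t', l', a, b, c) \<Rightarrow> voltages t l m t' l' a b c)"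

text \<open>A voltage and its negative vanish together, and only the parity of the coefficient of
  \<open>k\<close> matters modulo \<open>2k\<close>. Merging such voltages keeps the lists of
  congruences short.\<close>

fun norm_voltage :: "int \<times> int \<times> int \<Rightarrow> int \<times> int \<times> int" where
  "norm_voltage (a, b, c) = (if a < 0 \<or> a = 0 \<and> b < 0 then (- a, - b, c mod 2) else (a, b, c mod 2))"

fun closing :: "nat \<Rightarrow> int \<Rightarrow> int \<Rightarrow> int \<times> int \<times> int \<Rightarrow> bool" where
  "closing k r s (a, b, c) \<longleftrightarrow> 2 * int k dvd a * r + b * s + c * int k"

text \<open>Grouping equal voltages makes the number of closed walks a fixed linear combination of
  the truth values of a few congruences.\<close>

lemma length_filter_tally:
  assumes "set xs \<subseteq> set ks" "distinct ks"
  shows "length (filter P xs) = (\<Sum>q\<leftarrow>ks. count_list xs q * of_bool (P q))"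
proof -
  have "length (filter P xs) = (\<Sum>q\<in>set ks. count_list xs q * of_bool (P q))"
    using assms(1)
  proof (induction xs)
    case (Cons x xs)
    have "(\<Sum>q\<in>set ks. count_list (x # xs) q * of_bool (P q))
      = (\<Sum>q\<in>set ks. (if x = q then of_bool (P x) else 0) + count_list xs q * of_bool (P q))"
      by (intro sum.cong) auto
    also have "\<dots> = of_bool (P x) + (\<Sum>q\<in>set ks. count_list xs q * of_bool (P q))"
      using Cons.prems by (simp add: sum.distrib)
    finally show ?case using Cons by auto
  qed simp
  then show ?thesis using assms(2) by (simp add: sum_list_distinct_conv_sum_set)
qed

lemma closing_norm_voltage: "closing k r s (norm_voltage v) = closing k r s v"
proof -
  obtain a b c where v: "v = (a, b, c)" by (cases v)
  have 1: "2 * int k dvd x + (c mod 2) * int k \<longleftrightarrow> 2 * int k dvd x + c * int k" for x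
  proof -
    have "c * int k = (c mod 2) * int k + (2 * int k) * (c div 2)"
      by (metis distrib_right minus_div_mult_eq_mod mult.assoc mult.commute add.commute mod_mult_div_eq)
    then show ?thesis by (metis add.assoc dvd_add_times_triv_right_iff mult.commute)
  qed
  have 2: "2 * int k dvd - x + c * int k \<longleftrightarrow> 2 * int k dvd x + c * int k" for x
  proof -
    have "- x + c * int k = - (x + c * int k) + (2 * int k) * c" by simp
    then show ?thesis by (metis dvd_add_times_triv_right_iff dvd_minus_iff mult.commute)
  qed
  show ?thesis using 1 2[of "a * r + b * s"] by (auto simp: v)
qed

context
  fixes k :: nat and r s :: int
  assumes k: "k > 0" and rs: "\<not> 2 * int k dvd r - s"
begin

lemma nbrs_vtx: "nbrs (T1 k r s) (vtx k t i) = (\<lambda>l. nbr k r s t l i) ` {0, 1, 2}"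
  by (cases t) (auto simp: nbrs_T1[OF k] nbr_def numeral_2_eq_2)

text \<open>This rests on \<open>r\<close> and \<open>s\<close> being distinct modulo
  \<open>2k\<close>; otherwise two of the edges at \<open>v_i\<close> would coincide.\<close>

lemma nbr_inj: "inj_on (\<lambda>l. nbr k r s t l i) {0, 1, 2}"
proof -
  have "\<not> 2 * int k dvd s - r" using rs by (metis dvd_minus_iff minus_diff_eq)
  then show ?thesis
    using rs by (cases t) (auto simp: inj_on_def nbr_def vtx_eq_iff numeral_2_eq_2)
qed

lemma nbr_eq_iff:
  "l \<in> {0, 1, 2} \<Longrightarrow> l' \<in> {0, 1, 2} \<Longrightarrow> nbr k r s t l i = nbr k r s t l' i \<longleftrightarrow> l = l'"
  using nbr_inj[of t i] by (meson inj_onD)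

text \<open>Confirms the reverse labels in the table \<open>steps\<close>, one arc at a
  time.\<close>

lemma nbr_reverse:
  assumes "j \<in> {0, 1, 2}" "steps t ! j = (t', l', a, b, c)"
  shows "nbr k r s t' l' (i + a * r + b * s + c * int k) = vtx k t i" "l' \<in> {0, 1, 2}"
  using assms by (cases t; force simp: nbr_def vtx_eq_iff numeral_2_eq_2)+

lemma nbr_cong: "2 * int k dvd i - j \<Longrightarrow> nbr k r s t l i = nbr k r s t l j"
  by (auto simp: nbr_def vtx_eq_iff split: prod.split)

text \<open>Induction along the walk: the current index is the initial one plus the accumulated
  voltage, so that returning to the start is the congruence \<open>closing\<close>.\<close>

lemma walks_T1:
  assumes "l \<in> {0, 1, 2}" "l0 \<in> {0, 1, 2}" "i = i0 + a * r + b * s + c * int k"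
  shows "walks (nbrs (T1 k r s)) (vtx k t0 i0) (nbr k r s t0 l0 i0) m (nbr k r s t l i) (vtx k t i)
    = length (filter (closing k r s) (voltages t0 l0 m t l a b c))"
  using assms(1,3)
proof (induction m arbitrary: t l a b c i)
  case 0
  have "i - i0 = a * r + b * s + c * int k" using 0 by simp
  then have "vtx k t i = vtx k t0 i0 \<longleftrightarrow> t = t0 \<and> closing k r s (a, b, c)"
    by (simp add: vtx_eq_iff)
  \<comment> \<open>Once the walk has closed, the last and the first arc are seen from the same
    vertex and can be compared by their labels.\<close>
  moreover have "nbr k r s t l i = nbr k r s t l i0" if "closing k r s (a, b, c)"
    using that \<open>i - i0 = _\<close> by (intro nbr_cong) simp
  ultimately show ?case using 0 assms(2) nbr_eq_iff[of l l0 t i0] by auto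
next
  case (Suc m)
  let ?W = "\<lambda>p c. walks (nbrs (T1 k r s)) (vtx k t0 i0) (nbr k r s t0 l0 i0) m p c"
  have step: "?W (vtx k t i) (nbr k r s t j i) = length (filter (closing k r s)
      (case steps t ! j of (t', l', a', b', c') \<Rightarrow> voltages t0 l0 m t' l' (a + a') (b + b') (c + c')))"
    if j: "j \<in> {0, 1, 2}" for j
  proof -
    obtain t' l' a' b' c' where st: "steps t ! j = (t', l', a', b', c')" by (metis prod_cases5)
    let ?i = "i + a' * r + b' * s + c' * int k"
    have "?W (nbr k r s t' l' ?i) (vtx k t' ?i)
      = length (filter (closing k r s) (voltages t0 l0 m t' l' (a + a') (b + b') (c + c')))"
      using nbr_reverse(2)[OF j st] Suc.prems(2) by (intro Suc.IH) (auto simp: algebra_simps)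
    moreover have "nbr k r s t j i = vtx k t' ?i" by (simp add: nbr_def st)
    ultimately show ?thesis using nbr_reverse(1)[OF j st] st by simp
  qed
  have "nbrs (T1 k r s) (vtx k t i) - {nbr k r s t l i} = (\<lambda>j. nbr k r s t j i) ` ({0, 1, 2} - {l})"
    unfolding nbrs_vtx
    by (subst inj_on_image_set_diff[OF nbr_inj[of t i]]) (use Suc.prems(1) in auto)
  then have "walks (nbrs (T1 k r s)) (vtx k t0 i0) (nbr k r s t0 l0 i0) (Suc m) (nbr k r s t l i) (vtx k t i)
    = (\<Sum>z\<in>(\<lambda>j. nbr k r s t j i) ` ({0, 1, 2} - {l}). ?W (vtx k t i) z)"
    by simp
  also have "\<dots> = (\<Sum>j\<in>{0, 1, 2} - {l}. ?W (vtx k t i) (nbr k r s t j i))"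
    by (rule sum.reindex_cong[OF inj_on_subset[OF nbr_inj]]) auto
  also have "\<dots> = (\<Sum>j\<in>{0, 1, 2} - {l}. length (filter (closing k r s)
      (case steps t ! j of (t', l', a', b', c') \<Rightarrow> voltages t0 l0 m t' l' (a + a') (b + b') (c + c'))))"
    using step by (intro sum.cong) auto
  also have "\<dots> = length (filter (closing k r s) (voltages t0 l0 (Suc m) t l a b c))"
    using Suc.prems(1) by (auto simp: numeral_2_eq_2 insert_Diff_if)
  finally show ?case .
qed

lemma arc_count_T1:
  assumes "l \<in> {0, 1, 2}"
    and "set (map norm_voltage (start_voltages t l m)) \<subseteq> set ks" "distinct ks"
  shows "arc_count (T1 k r s) m (vtx k t i) (nbr k r s t l i)
    = (\<Sum>q\<leftarrow>ks. count_list (map norm_voltage (start_voltages t l m)) q * of_bool (closing k r s q))"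
proof -
  obtain t' l' a b c where st: "steps t ! l = (t', l', a, b, c)" by (metis prod_cases5)
  let ?i = "i + a * r + b * s + c * int k"
  have "arc_count (T1 k r s) m (vtx k t i) (nbr k r s t l i) =
     walks (nbrs (T1 k r s)) (vtx k t i) (nbr k r s t l i) m (nbr k r s t' l' ?i) (vtx k t' ?i)"
    using nbr_reverse[OF assms(1) st] by (simp add: arc_count_def nbr_def[of k r s t l] st)
  also have "\<dots> = length (filter (closing k r s) (start_voltages t l m))"
    using walks_T1[OF nbr_reverse(2)[OF assms(1) st] assms(1) refl] by (simp add: start_voltages_def st)
  also have "\<dots> = length (filter (closing k r s) (map norm_voltage (start_voltages t l m)))"
    by (simp add: filter_map comp_def closing_norm_voltage)
  finally show ?thesis using length_filter_tally[OF assms(2,3)] by simp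
qed

end


definition all_start_voltages :: "vtype \<Rightarrow> nat \<Rightarrow> (int \<times> int \<times> int) list" where
  "all_start_voltages t m = concat (map (\<lambda>l. start_voltages t l m) [0, 1, 2])"

lemma sum_arc_count_T1:
  assumes k: "k > 0" and rs: "\<not> 2 * int k dvd r - s"
    and ks: "set (map norm_voltage (all_start_voltages t m)) \<subseteq> set ks" "distinct ks"
  shows "(\<Sum>z\<in>nbrs (T1 k r s) (vtx k t i). arc_count (T1 k r s) m (vtx k t i) z)
    = (\<Sum>q\<leftarrow>ks. count_list (map norm_voltage (all_start_voltages t m)) q * of_bool (closing k r s q))"
proof -
  have "(\<Sum>z\<in>nbrs (T1 k r s) (vtx k t i). arc_count (T1 k r s) m (vtx k t i) z)
    = (\<Sum>l\<in>{0, 1, 2}. arc_count (T1 k r s) m (vtx k t i) (nbr k r s t l i))"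
    unfolding nbrs_vtx[OF k rs] by (rule sum.reindex_cong[OF nbr_inj[OF k rs]]) auto
  also have "\<dots> = (\<Sum>l\<in>{0, 1, 2}. \<Sum>q\<leftarrow>ks. count_list (map norm_voltage (start_voltages t l m)) q * of_bool (closing k r s q))"
    using ks by (intro sum.cong refl arc_count_T1[OF k rs]) (auto simp: all_start_voltages_def)
  also have "\<dots> = (\<Sum>q\<leftarrow>ks. count_list (map norm_voltage (all_start_voltages t m)) q * of_bool (closing k r s q))"
    by (simp add: all_start_voltages_def sum_list_addf[symmetric] algebra_simps)
  finally show ?thesis .
qed

section \<open>Tallies of closed walks of lengths 4, 7 and 8\<close>

definition keys4 :: "(int \<times> int \<times> int) list" where
  "keys4 = [(0, 1, 1), (1, 0, 1), (2, -2, 0)]"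

text \<open>Found by evaluation, in the order of \<open>keys4\<close>. The same keys serve for
  \<open>u\<close> and \<open>v\<close>, so a key that occurs at only one of them gets the
  coefficient 0 at the other.\<close>

lemma tally4_u:
  "set (map norm_voltage (all_start_voltages TU 3)) \<subseteq> set keys4"
  "map (count_list (map norm_voltage (all_start_voltages TU 3))) keys4 = [4, 4, 0]"
  unfolding keys4_def by code_simp+

lemma tally4_v:
  "set (map norm_voltage (all_start_voltages TV 3)) \<subseteq> set keys4"
  "map (count_list (map norm_voltage (all_start_voltages TV 3))) keys4 = [2, 2, 2]"
  unfolding keys4_def by code_simp+

definition keys7 :: "(int \<times> int \<times> int) list" where
  "keys7 = [(0, 2, 1), (1, 1, 1), (2, -3, 0), (2, -2, 1), (2, 0, 1), (3, -2, 0)]"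

lemma tally7_u:
  "set (map norm_voltage (all_start_voltages TU 6)) \<subseteq> set keys7"
  "map (count_list (map norm_voltage (all_start_voltages TU 6))) keys7 = [6, 12, 2, 8, 6, 2]"
  unfolding keys7_def by code_simp+

lemma tally7_v:
  "set (map norm_voltage (all_start_voltages TV 6)) \<subseteq> set keys7"
  "map (count_list (map norm_voltage (all_start_voltages TV 6))) keys7 = [4, 8, 6, 10, 4, 6]"
  unfolding keys7_def by code_simp+

text \<open>The voltage \<open>(0, 0, 0)\<close> closes in every \<open>T1 k r s\<close>: an example
  is the closed walk through \<open>u_i\<close>, \<open>v_i\<close>, \<open>w_(i+r)\<close>,
  \<open>u_(i+r)\<close>, \<open>u_(i+r+k)\<close>, \<open>w_(i+r+k)\<close>,
  \<open>v_(i+k)\<close>, \<open>u_(i+k)\<close>.\<close>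

definition keys8 :: "(int \<times> int \<times> int) list" where
  "keys8 = [(0, 0, 0), (0, 1, 1), (0, 2, 0), (1, -3, 0), (1, -2, 1), (1, -1, 0), (1, 0, 1), (1, 1, 0), (2, -3, 1), (2, -2, 0), (2, -1, 1), (2, 0, 0), (3, -2, 1), (3, -1, 0), (4, -4, 0)]"

text \<open>Length 8 is tallied arc by arc, since later the counts of the single arcs matter and not
  only their sum at a vertex.\<close>

lemma tally8_u0:
  "set (map norm_voltage (start_voltages TU 0 7)) \<subseteq> set keys8"
  "map (count_list (map norm_voltage (start_voltages TU 0 7))) keys8 = [4, 4, 2, 0, 4, 4, 4, 4, 2, 0, 4, 2, 2, 0, 0]"
  unfolding keys8_def by code_simp+

lemma tally8_u1:
  "set (map norm_voltage (start_voltages TU 1 7)) \<subseteq> set keys8"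
  "map (count_list (map norm_voltage (start_voltages TU 1 7))) keys8 = [4, 4, 3, 2, 4, 2, 4, 2, 1, 2, 4, 3, 1, 2, 0]"
  unfolding keys8_def by code_simp+

lemma tally8_u2:
  "set (map norm_voltage (start_voltages TU 2 7)) \<subseteq> set keys8"
  "map (count_list (map norm_voltage (start_voltages TU 2 7))) keys8 = [4, 4, 3, 2, 4, 2, 4, 2, 1, 2, 4, 3, 1, 2, 0]"
  unfolding keys8_def by code_simp+

lemma tally8_v0:
  "set (map norm_voltage (start_voltages TV 0 7)) \<subseteq> set keys8"
  "map (count_list (map norm_voltage (start_voltages TV 0 7))) keys8 = [4, 4, 3, 2, 4, 2, 4, 2, 1, 2, 4, 3, 1, 2, 0]"
  unfolding keys8_def by code_simp+

lemma tally8_v1: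
  "set (map norm_voltage (start_voltages TV 1 7)) \<subseteq> set keys8"
  "map (count_list (map norm_voltage (start_voltages TV 1 7))) keys8 = [3, 4, 2, 1, 2, 1, 2, 1, 2, 2, 4, 3, 3, 3, 1]"
  unfolding keys8_def by code_simp+

lemma tally8_v2:
  "set (map norm_voltage (start_voltages TV 2 7)) \<subseteq> set keys8"
  "map (count_list (map norm_voltage (start_voltages TV 2 7))) keys8 = [3, 2, 3, 3, 4, 1, 4, 1, 3, 2, 2, 2, 2, 1, 1]"
  unfolding keys8_def by code_simp+

lemma tally8_w0:
  "set (map norm_voltage (start_voltages TW 0 7)) \<subseteq> set keys8"
  "map (count_list (map norm_voltage (start_voltages TW 0 7))) keys8 = [4, 4, 3, 2, 4, 2, 4, 2, 1, 2, 4, 3, 1, 2, 0]"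
  unfolding keys8_def by code_simp+

lemma tally8_w1:
  "set (map norm_voltage (start_voltages TW 1 7)) \<subseteq> set keys8"
  "map (count_list (map norm_voltage (start_voltages TW 1 7))) keys8 = [3, 4, 2, 1, 2, 1, 2, 1, 2, 2, 4, 3, 3, 3, 1]"
  unfolding keys8_def by code_simp+

lemma tally8_w2:
  "set (map norm_voltage (start_voltages TW 2 7)) \<subseteq> set keys8"
  "map (count_list (map norm_voltage (start_voltages TW 2 7))) keys8 = [3, 2, 3, 3, 4, 1, 4, 1, 3, 2, 2, 2, 2, 1, 1]"
  unfolding keys8_def by code_simp+

section \<open>Relations forced by vertex-transitivity\<close>

lemma sum_list_mult_eq_zip:
  fixes f g :: "'a \<Rightarrow> nat"
  shows "map f ks = cs \<Longrightarrow> (\<Sum>q\<leftarrow>ks. f q * g q) = (\<Sum>(q, c)\<leftarrow>zip ks cs. c * g q)"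
  by (induction ks arbitrary: cs) auto

lemma distinct_keys: "distinct keys4" "distinct keys7" "distinct keys8"
  by (simp_all add: keys4_def keys7_def keys8_def)

text \<open>An automorphism from \<open>u_0\<close> to \<open>v_0\<close> equates the counts of
  lengths 4, 7 and 8. If all four relations failed, these equations would give
  \<open>2r - 2s = k\<close> modulo \<open>2k\<close> and then make \<open>k div 2\<close> a common
  divisor of \<open>k\<close>, \<open>r\<close>, \<open>s\<close>, against connectedness.\<close>

lemma vertex_transitive_T1_relation:
  assumes k: "k \<ge> 9" and rs: "\<not> 2 * int k dvd r - s"
    and con: "connected (with_proj (T1 k r s))" and vt: "vertex_transitive (T1 k r s)"
  shows "2 * int k dvd r - 3 * s \<or> 2 * int k dvd 3 * r - s \<or>
    2 * int k dvd 2 * r - 3 * s + int k \<or> 2 * int k dvd 3 * r - 2 * s + int k"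
proof (rule ccontr)
  assume neg: "\<not> ?thesis"
  have k0: "k > 0" using k by simp
  let ?n = "2 * int k"
  let ?E = "\<lambda>a b c. of_bool (closing k r s (a, b, c)) :: nat"
  obtain f where f: "pair_iso f (T1 k r s) (T1 k r s)" "f (vtx k TU 0) = vtx k TV 0"
    using vt vtx_in_T1[OF k0] unfolding vertex_transitive_iff by blast
  have eq: "(\<Sum>z\<in>nbrs (T1 k r s) (vtx k TV 0). arc_count (T1 k r s) m (vtx k TV 0) z)
    = (\<Sum>z\<in>nbrs (T1 k r s) (vtx k TU 0). arc_count (T1 k r s) m (vtx k TU 0) z)" for m
    using sum_arc_count_pair_iso[OF pair_wf_T1[OF k0] pair_wf_T1[OF k0] f(1) vtx_in_T1[OF k0]] f(2)
    by metis
  note count = sum_arc_count_T1[OF k0 rs]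
  have e4: "2 * ?E 0 1 1 + 2 * ?E 1 0 1 + 2 * ?E 2 (-2) 0 = 4 * ?E 0 1 1 + 4 * ?E 1 0 1"
    using eq[of 3] unfolding count[OF tally4_u(1) distinct_keys(1)] count[OF tally4_v(1) distinct_keys(1)]
      sum_list_mult_eq_zip[OF tally4_u(2)] sum_list_mult_eq_zip[OF tally4_v(2)]
    by (simp add: keys4_def del: closing.simps)
  have e7: "4 * ?E 0 2 1 + 8 * ?E 1 1 1 + 6 * ?E 2 (-3) 0 + 10 * ?E 2 (-2) 1 + 4 * ?E 2 0 1 + 6 * ?E 3 (-2) 0
    = 6 * ?E 0 2 1 + 12 * ?E 1 1 1 + 2 * ?E 2 (-3) 0 + 8 * ?E 2 (-2) 1 + 6 * ?E 2 0 1 + 2 * ?E 3 (-2) 0"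
    using eq[of 6] unfolding count[OF tally7_u(1) distinct_keys(2)] count[OF tally7_v(1) distinct_keys(2)]
      sum_list_mult_eq_zip[OF tally7_u(2)] sum_list_mult_eq_zip[OF tally7_v(2)]
    by (simp add: keys7_def del: closing.simps)
  have sub8: "set (map norm_voltage (all_start_voltages t 7)) \<subseteq> set keys8" if "t = TU \<or> t = TV" for t
    using that tally8_u0(1) tally8_u1(1) tally8_u2(1) tally8_v0(1) tally8_v1(1) tally8_v2(1)
    by (auto simp: all_start_voltages_def)
  have tally8: "map (count_list (map norm_voltage (all_start_voltages t 7))) keys8
    = map (\<lambda>(x, y, z). x + y + z) (zip (map (count_list (map norm_voltage (start_voltages t 0 7))) keys8)
       (zip (map (count_list (map norm_voltage (start_voltages t 1 7))) keys8)
         (map (count_list (map norm_voltage (start_voltages t 2 7))) keys8)))" for t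
    by (simp add: all_start_voltages_def zip_map_map zip_same_conv_map)
  have u8: "map (count_list (map norm_voltage (all_start_voltages TU 7))) keys8
    = [12, 12, 8, 4, 12, 8, 12, 8, 4, 4, 12, 8, 4, 4, 0]"
    unfolding tally8 tally8_u0(2) tally8_u1(2) tally8_u2(2) by simp
  have v8: "map (count_list (map norm_voltage (all_start_voltages TV 7))) keys8
    = [10, 10, 8, 6, 10, 4, 10, 4, 6, 6, 10, 8, 6, 6, 2]"
    unfolding tally8 tally8_v0(2) tally8_v1(2) tally8_v2(2) by simp
  have e8: "10 * ?E 0 0 0 + 10 * ?E 0 1 1 + 8 * ?E 0 2 0 + 6 * ?E 1 (-3) 0 + 10 * ?E 1 (-2) 1 + 4 * ?E 1 (-1) 0
      + 10 * ?E 1 0 1 + 4 * ?E 1 1 0 + 6 * ?E 2 (-3) 1 + 6 * ?E 2 (-2) 0 + 10 * ?E 2 (-1) 1 + 8 * ?E 2 0 0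
      + 6 * ?E 3 (-2) 1 + 6 * ?E 3 (-1) 0 + 2 * ?E 4 (-4) 0
    = 12 * ?E 0 0 0 + 12 * ?E 0 1 1 + 8 * ?E 0 2 0 + 4 * ?E 1 (-3) 0 + 12 * ?E 1 (-2) 1 + 8 * ?E 1 (-1) 0
      + 12 * ?E 1 0 1 + 8 * ?E 1 1 0 + 4 * ?E 2 (-3) 1 + 4 * ?E 2 (-2) 0 + 12 * ?E 2 (-1) 1 + 8 * ?E 2 0 0
      + 4 * ?E 3 (-2) 1 + 4 * ?E 3 (-1) 0"
    using eq[of 7] unfolding count[OF sub8 distinct_keys(3), OF disjI1[OF refl]] count[OF sub8 distinct_keys(3), OF disjI2[OF refl]]
      sum_list_mult_eq_zip[OF u8] sum_list_mult_eq_zip[OF v8]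
    by (simp add: keys8_def del: closing.simps)
  have div: "d dvd 1" if "d dvd int k" "d dvd r" "d dvd s" for d
    using T1_connected_common_divisor[OF k0 con that] .
  have not1: "\<not> int k dvd 1" using k by simp
  \<comment> \<open>By \<open>e4\<close>, one of \<open>r + k\<close> and \<open>s + k\<close> would
    vanish too, and \<open>k\<close> would divide both \<open>r\<close> and
    \<open>s\<close>.\<close>
  have n22: "\<not> ?n dvd 2 * r - 2 * s"
  proof
    assume a: "?n dvd 2 * r - 2 * s"
    then have "int k dvd r - s" by (metis dvd_mult_cancel_left right_diff_distrib zero_neq_numeral)
    moreover have "?n dvd s + int k \<or> ?n dvd r + int k"
      using e4 a by (auto simp: of_bool_def split: if_splits)
    then have "int k dvd s + int k \<or> int k dvd r + int k"
      by (meson dvd_mult_right)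
    then have "int k dvd r \<or> int k dvd s" by auto
    ultimately have "int k dvd r \<and> int k dvd s"
      by (metis dvd_diff_right_iff dvd_diff_left_iff)
    then show False using div[of "int k"] not1 by simp
  qed
  have n01: "\<not> ?n dvd s + int k" "\<not> ?n dvd r + int k"
    using e4 n22 by (auto simp: of_bool_def split: if_splits)
  \<comment> \<open>The key \<open>(0, 0, 0)\<close> contributes 12 at \<open>u\<close> and only 10
    at \<open>v\<close>. Of the keys not yet excluded, \<open>(4, -4, 0)\<close> alone counts more
    at \<open>v\<close> than at \<open>u\<close>, so it has to close.\<close>
  have "?n dvd 4 * r - 4 * s"
    using e8 neg n01 n22 rs by (auto simp: of_bool_def split: if_splits)
  moreover define x where "x = r - s"
  ultimately obtain m where "4 * x = ?n * m" by (auto simp: dvd_def algebra_simps)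
  then have m: "2 * x = int k * m" by simp
  have "odd m"
  proof
    assume "even m"
    then have "?n dvd 2 * x" using m by (auto simp: dvd_def)
    then show False using n22 by (simp add: x_def)
  qed
  then obtain m' where "m = 2 * m' + 1" by (auto elim: oddE)
  then have "2 * r - 2 * s + int k = ?n * (m' + 1)" using m by (simp add: x_def algebra_simps)
  then have d1: "?n dvd 2 * r - 2 * s + int k" by simp
  \<comment> \<open>With \<open>d1\<close>, and with both of these congruences false, the two sides
    of \<open>e7\<close> would differ by 2 modulo 4.\<close>
  have d2: "?n dvd 2 * s + int k \<or> ?n dvd 2 * r + int k"
  proof (rule ccontr)
    assume "\<not> ?thesis"
    then have "4 * ?E 1 1 1 = 4 * ?E 2 (-3) 0 + 4 * ?E 3 (-2) 0 + 2"
      using e7 d1 by simp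
    then show False by (auto simp: of_bool_def split: if_splits)
  qed
  obtain l where l: "2 * r - 2 * s + int k = ?n * l" using d1 by (auto simp: dvd_def)
  then have "int k = 2 * (int k * l - r + s)" by (simp add: algebra_simps)
  then obtain h where h: "int k = 2 * h" by blast
  \<comment> \<open>Halving \<open>d1\<close> and \<open>d2\<close> shows that \<open>r - s\<close>
    and one of \<open>r\<close>, \<open>s\<close> are multiples of \<open>h\<close>, half of
    \<open>k\<close>.\<close>
  have "h dvd r \<and> h dvd s"
  proof -
    have 1: "2 * (r - s + h) = 2 * (h * (2 * l))" using l h by (simp add: algebra_simps)
    then have "r - s = h * (2 * l - 1)" by (simp add: algebra_simps)
    then have a: "h dvd r - s" by simp
    have "h dvd s \<or> h dvd r"
    proof -
      have "\<exists>y. 2 * z + 2 * h = 4 * h * y \<Longrightarrow> h dvd z" for z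
      proof -
        assume "\<exists>y. 2 * z + 2 * h = 4 * h * y"
        then obtain y where "2 * z + 2 * h = 4 * h * y" by blast
        then have "z = h * (2 * y - 1)" by (simp add: algebra_simps)
        then show ?thesis by simp
      qed
      then show ?thesis using d2 h by (auto simp: dvd_def)
    qed
    then show ?thesis using a by (metis dvd_diff_right_iff dvd_diff_left_iff)
  qed
  then have "h dvd 1" using div[of h] h by (metis dvd_triv_right)
  then show False using h k by auto
qed

text \<open>
  In both surviving families the indices modulo \<open>k\<close> are multiples of a unit \<open>t\<close>, so a relation
  between \<open>r\<close>, \<open>s\<close>, \<open>k\<close> with small coefficients holds modulo \<open>k\<close> only if it holds identically.
\<close>

lemma closing_zero:
  assumes "coprime t (int k)" "int k dvd r - x * t" "int k dvd s - y * t"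
    and "closing k r s (a, b, c)" "\<bar>a * x + b * y\<bar> < int k"
  shows "a * x + b * y = 0"
proof -
  have "2 * int k dvd a * r + b * s + c * int k" using assms(4) by simp
  then have "int k dvd a * r + b * s + c * int k" by (rule dvd_mult_right)
  then have "int k dvd a * r + b * s" by simp
  moreover have "int k dvd a * (r - x * t) + b * (s - y * t)" using assms(2,3) by simp
  ultimately have "int k dvd (a * r + b * s) - (a * (r - x * t) + b * (s - y * t))" by (rule dvd_diff)
  then have "int k dvd (a * x + b * y) * t" by (simp add: algebra_simps)
  then have "int k dvd a * x + b * y" using assms(1) by (simp add: coprime_dvd_mult_left_iff coprime_commute)
  then show ?thesis using assms(5) zdvd_not_zless[of "\<bar>a * x + b * y\<bar>" "int k"] by fastforce
qed

text \<open>All arcs are covered: \<open>\<alpha>\<close> belongs to the perfect matching of the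
  edges between \<open>u_i\<close> and \<open>u_(i+k)\<close> and between \<open>v_i\<close> and
  \<open>w_(i+s)\<close>, and \<open>\<beta>\<close> to every other arc. If
  \<open>\<alpha> \<noteq> \<beta>\<close>, automorphisms preserve both the matching and its
  complement.\<close>

definition matched_arc_counts :: "nat \<Rightarrow> int \<Rightarrow> int \<Rightarrow> nat \<Rightarrow> nat \<Rightarrow> bool" where
  "matched_arc_counts k r s \<alpha> \<beta> \<longleftrightarrow> (\<forall>i.
     arc_count (T1 k r s) 7 (vtx k TU i) (vtx k TU (i + int k)) = \<alpha> \<and>
     arc_count (T1 k r s) 7 (vtx k TU i) (vtx k TV i) = \<beta> \<and>
     arc_count (T1 k r s) 7 (vtx k TU i) (vtx k TW i) = \<beta> \<and>
     arc_count (T1 k r s) 7 (vtx k TV i) (vtx k TU i) = \<beta> \<and>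
     arc_count (T1 k r s) 7 (vtx k TV i) (vtx k TW (i + r)) = \<beta> \<and>
     arc_count (T1 k r s) 7 (vtx k TV i) (vtx k TW (i + s)) = \<alpha> \<and>
     arc_count (T1 k r s) 7 (vtx k TW i) (vtx k TU i) = \<beta> \<and>
     arc_count (T1 k r s) 7 (vtx k TW i) (vtx k TV (i - r)) = \<beta> \<and>
     arc_count (T1 k r s) 7 (vtx k TW i) (vtx k TV (i - s)) = \<alpha>)"

lemma arc_count8:
  assumes k: "k > 0" and rs: "\<not> 2 * int k dvd r - s"
  defines "g \<equiv> \<lambda>cs. (\<Sum>(q, c)\<leftarrow>zip keys8 cs. c * of_bool (closing k r s q))"
  shows "arc_count (T1 k r s) 7 (vtx k TU i) (vtx k TU (i + int k)) = g [4, 4, 2, 0, 4, 4, 4, 4, 2, 0, 4, 2, 2, 0, 0]"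
    and "arc_count (T1 k r s) 7 (vtx k TU i) (vtx k TV i) = g [4, 4, 3, 2, 4, 2, 4, 2, 1, 2, 4, 3, 1, 2, 0]"
    and "arc_count (T1 k r s) 7 (vtx k TU i) (vtx k TW i) = g [4, 4, 3, 2, 4, 2, 4, 2, 1, 2, 4, 3, 1, 2, 0]"
    and "arc_count (T1 k r s) 7 (vtx k TV i) (vtx k TU i) = g [4, 4, 3, 2, 4, 2, 4, 2, 1, 2, 4, 3, 1, 2, 0]"
    and "arc_count (T1 k r s) 7 (vtx k TV i) (vtx k TW (i + r)) = g [3, 4, 2, 1, 2, 1, 2, 1, 2, 2, 4, 3, 3, 3, 1]"
    and "arc_count (T1 k r s) 7 (vtx k TV i) (vtx k TW (i + s)) = g [3, 2, 3, 3, 4, 1, 4, 1, 3, 2, 2, 2, 2, 1, 1]"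
    and "arc_count (T1 k r s) 7 (vtx k TW i) (vtx k TU i) = g [4, 4, 3, 2, 4, 2, 4, 2, 1, 2, 4, 3, 1, 2, 0]"
    and "arc_count (T1 k r s) 7 (vtx k TW i) (vtx k TV (i - r)) = g [3, 4, 2, 1, 2, 1, 2, 1, 2, 2, 4, 3, 3, 3, 1]"
    and "arc_count (T1 k r s) 7 (vtx k TW i) (vtx k TV (i - s)) = g [3, 2, 3, 3, 4, 1, 4, 1, 3, 2, 2, 2, 2, 1, 1]"
proof -
  have *: "arc_count (T1 k r s) 7 (vtx k t i) (nbr k r s t l i) = g cs"
    if "l \<in> {0, 1, 2}" "set (map norm_voltage (start_voltages t l 7)) \<subseteq> set keys8"
      "map (count_list (map norm_voltage (start_voltages t l 7))) keys8 = cs" for t l cs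
    unfolding arc_count_T1[OF k rs that(1,2) distinct_keys(3)] g_def
    by (rule sum_list_mult_eq_zip[OF that(3)])
  note [simp] = nbr_def numeral_2_eq_2
  show "arc_count (T1 k r s) 7 (vtx k TU i) (vtx k TU (i + int k)) = g [4, 4, 2, 0, 4, 4, 4, 4, 2, 0, 4, 2, 2, 0, 0]"
    using *[OF _ tally8_u0] by simp
  show "arc_count (T1 k r s) 7 (vtx k TU i) (vtx k TV i) = g [4, 4, 3, 2, 4, 2, 4, 2, 1, 2, 4, 3, 1, 2, 0]"
    using *[OF _ tally8_u1] by simp
  show "arc_count (T1 k r s) 7 (vtx k TU i) (vtx k TW i) = g [4, 4, 3, 2, 4, 2, 4, 2, 1, 2, 4, 3, 1, 2, 0]"
    using *[OF _ tally8_u2] by simp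
  show "arc_count (T1 k r s) 7 (vtx k TV i) (vtx k TU i) = g [4, 4, 3, 2, 4, 2, 4, 2, 1, 2, 4, 3, 1, 2, 0]"
    using *[OF _ tally8_v0] by simp
  show "arc_count (T1 k r s) 7 (vtx k TV i) (vtx k TW (i + r)) = g [3, 4, 2, 1, 2, 1, 2, 1, 2, 2, 4, 3, 3, 3, 1]"
    using *[OF _ tally8_v1] by simp
  show "arc_count (T1 k r s) 7 (vtx k TV i) (vtx k TW (i + s)) = g [3, 2, 3, 3, 4, 1, 4, 1, 3, 2, 2, 2, 2, 1, 1]"
    using *[OF _ tally8_v2] by simp
  show "arc_count (T1 k r s) 7 (vtx k TW i) (vtx k TU i) = g [4, 4, 3, 2, 4, 2, 4, 2, 1, 2, 4, 3, 1, 2, 0]"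
    using *[OF _ tally8_w0] by simp
  show "arc_count (T1 k r s) 7 (vtx k TW i) (vtx k TV (i - r)) = g [3, 4, 2, 1, 2, 1, 2, 1, 2, 2, 4, 3, 3, 3, 1]"
    using *[OF _ tally8_w1] by simp
  show "arc_count (T1 k r s) 7 (vtx k TW i) (vtx k TV (i - s)) = g [3, 2, 3, 3, 4, 1, 4, 1, 3, 2, 2, 2, 2, 1, 1]"
    using *[OF _ tally8_w2] by simp
qed

text \<open>Here \<open>r\<close> is a unit modulo \<open>k\<close> and \<open>s = 3r\<close>, so a
  voltage \<open>(a, b, c)\<close> can close only if \<open>a + 3b\<close> vanishes modulo
  \<open>k\<close>. This leaves \<open>(0, 0, 0)\<close> and \<open>(3, -1, 0)\<close>.\<close>

lemma matched_arc_counts_3r: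
  assumes k: "k \<ge> 9" and rs: "\<not> 2 * int k dvd r - s"
    and con: "connected (with_proj (T1 k r s))" and rel: "2 * int k dvd 3 * r - s"
  shows "matched_arc_counts k r s 4 6"
proof -
  have k0: "k > 0" using k by simp
  have ks: "int k dvd 3 * r - s" using rel by (rule dvd_mult_right)
  have cop: "coprime r (int k)"
  proof (rule coprimeI)
    fix d assume d: "d dvd r" "d dvd int k"
    then have "d dvd 3 * r - (3 * r - s)" using ks by (meson dvd_diff dvd_mult dvd_trans)
    then show "is_unit d" using T1_connected_common_divisor[OF k0 con d(2,1)] by simp
  qed
  \<comment> \<open>Over \<open>keys8\<close> the absolute value of \<open>a + 3b\<close> is at most
    8, attained at \<open>(1, -3, 0)\<close> and \<open>(4, -4, 0)\<close>; this is what
    \<open>k \<ge> 9\<close> is for.\<close>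
  have z: "a + b * 3 = 0" if "closing k r s (a, b, c)" "\<bar>a + b * 3\<bar> < int k" for a b c
    using closing_zero[OF cop, of r 1 s 3 a b c] that ks by (simp add: dvd_diff_commute)
  have cl: "closing k r s q \<longleftrightarrow> q \<in> {(0, 0, 0), (3, -1, 0)}" if "q \<in> set keys8" for q
  proof
    assume "closing k r s q"
    then show "q \<in> {(0, 0, 0), (3, -1, 0)}"
      using that z[of "fst q" "fst (snd q)" "snd (snd q)"] k unfolding keys8_def by auto
  next
    assume "q \<in> {(0, 0, 0), (3, -1, 0)}"
    then show "closing k r s q" using rel by auto
  qed
  have sums: "(\<Sum>(q, c)\<leftarrow>zip keys8 cs. c * of_bool (closing k r s q))
    = (\<Sum>(q, c)\<leftarrow>zip keys8 cs. c * of_bool (q \<in> {(0, 0, 0), (3, -1, 0)}))" for cs :: "nat list"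
    using cl by (intro arg_cong[of _ _ sum_list] map_cong refl) (auto dest!: set_zip_leftD)
  show ?thesis
    unfolding matched_arc_counts_def arc_count8[OF k0 rs] sums by (simp add: keys8_def)
qed

text \<open>Modulo \<open>k\<close> the relation reads \<open>2r = 3s\<close>, which makes
  \<open>r\<close> and \<open>s\<close> the triple and the double of \<open>r - s\<close>; by
  connectedness \<open>r - s\<close> is a unit. Only \<open>(0, 0, 0)\<close> and
  \<open>(2, -3, 1)\<close> satisfy \<open>3a + 2b = 0\<close> among \<open>keys8\<close>.\<close>

lemma matched_arc_counts_2r:
  assumes k: "k \<ge> 9" and rs: "\<not> 2 * int k dvd r - s"
    and con: "connected (with_proj (T1 k r s))" and rel: "2 * int k dvd 2 * r - 3 * s + int k"
  shows "matched_arc_counts k r s 5 4 \<or> matched_arc_counts k r s 6 5"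
proof -
  have k0: "k > 0" using k by simp
  have ks: "int k dvd 2 * r - 3 * s"
    using rel dvd_add_left_iff[of "int k" "int k"] by (meson dvd_mult_right dvd_refl)
  have s2: "int k dvd s - 2 * (r - s)" and r3: "int k dvd r - 3 * (r - s)"
    using ks dvd_minus_iff[of "int k" "2 * r - 3 * s"] by (simp_all add: algebra_simps)
  have cop: "coprime (r - s) (int k)"
  proof (rule coprimeI)
    fix d assume d: "d dvd r - s" "d dvd int k"
    have "d dvd s - 2 * (r - s) + 2 * (r - s)" "d dvd r - 3 * (r - s) + 3 * (r - s)"
      using s2 r3 d by (meson dvd_add dvd_mult dvd_trans)+
    then show "is_unit d" using T1_connected_common_divisor[OF k0 con d(2)] by simp
  qed
  have z: "a * 3 + b * 2 = 0" if "closing k r s (a, b, c)" "\<bar>a * 3 + b * 2\<bar> < int k" for a b c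
    using closing_zero[OF cop r3 s2 that] .
  have cl: "closing k r s q \<longleftrightarrow> q \<in> {(0, 0, 0), (2, -3, 1)}" if "q \<in> set keys8" for q
  proof
    assume "closing k r s q"
    then show "q \<in> {(0, 0, 0), (2, -3, 1)}"
      using that z[of "fst q" "fst (snd q)" "snd (snd q)"] k unfolding keys8_def by auto
  next
    assume "q \<in> {(0, 0, 0), (2, -3, 1)}"
    then show "closing k r s q" using rel by auto
  qed
  have sums: "(\<Sum>(q, c)\<leftarrow>zip keys8 cs. c * of_bool (closing k r s q))
    = (\<Sum>(q, c)\<leftarrow>zip keys8 cs. c * of_bool (q \<in> {(0, 0, 0), (2, -3, 1)}))" for cs :: "nat list"
    using cl by (intro arg_cong[of _ _ sum_list] map_cong refl) (auto dest!: set_zip_leftD)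
  show ?thesis
    unfolding matched_arc_counts_def arc_count8[OF k0 rs] sums by (simp add: keys8_def)
qed

section \<open>The 2-factor\<close>

text \<open>
  Position \<open>j\<close> on the path \<open>\<dots>, v\<^sub>i, u\<^sub>i, w\<^sub>i, v\<^bsub>i-r\<^esub>, \<dots>\<close> obtained by deleting the edges
  \<open>u\<^sub>i u\<^bsub>i+k\<^esub>\<close> and \<open>v\<^sub>i w\<^bsub>i+s\<^esub>\<close>.
\<close>

definition line :: "nat \<Rightarrow> int \<Rightarrow> int \<Rightarrow> int \<Rightarrow> t1_vertex" where
  "line k r i j = vtx k (if j mod 3 = 0 then TV else if j mod 3 = 1 then TU else TW) (i - (j div 3) * r)"

lemma line_simps:
  "line k r i (3 * m) = vtx k TV (i - m * r)"
  "line k r i (3 * m + 1) = vtx k TU (i - m * r)"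
  "line k r i (3 * m + 2) = vtx k TW (i - m * r)"
  by (simp_all add: line_def)

lemma int_mod3_cases:
  obtains m :: int where "j = 3 * m" | m where "j = 3 * m + 1" | m where "j = 3 * m + 2"
proof -
  have "j = 3 * (j div 3) + j mod 3" by simp
  moreover have "j mod 3 = 0 \<or> j mod 3 = 1 \<or> j mod 3 = 2" by presburger
  ultimately show ?thesis using that by (metis add_0_right)
qed

text \<open>The neighbours along the 2-factor, described by arc counts so that automorphisms visibly
  preserve them.\<close>

definition line_nbrs :: "nat \<Rightarrow> int \<Rightarrow> int \<Rightarrow> nat \<Rightarrow> t1_vertex \<Rightarrow> t1_vertex set" where
  "line_nbrs k r s \<beta> x = {y \<in> nbrs (T1 k r s) x. arc_count (T1 k r s) 7 x y = \<beta>}"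

lemma line_nbrs_line:
  assumes "k > 0" "matched_arc_counts k r s \<alpha> \<beta>" "\<alpha> \<noteq> \<beta>"
  shows "line_nbrs k r s \<beta> (line k r i j) = {line k r i (j - 1), line k r i (j + 1)}"
proof (cases j rule: int_mod3_cases)
  case (1 m)
  have "3 * m - 1 = 3 * (m - 1) + 2" by simp
  then have "line k r i (j - 1) = vtx k TW (i - m * r + r)"
    using line_simps(3)[of k r i "m - 1"] 1 by (simp add: algebra_simps)
  then show ?thesis
    using assms by (auto simp: 1 line_simps line_nbrs_def nbrs_T1 matched_arc_counts_def)
next
  case (2 m)
  have "j - 1 = 3 * m" "j + 1 = 3 * m + 2" using 2 by simp_all
  then have "line k r i (j - 1) = vtx k TV (i - m * r)" "line k r i (j + 1) = vtx k TW (i - m * r)"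
    "line k r i j = vtx k TU (i - m * r)"
    unfolding 2 by (simp_all only: line_simps)
  then show ?thesis
    using assms by (auto simp: line_nbrs_def nbrs_T1 matched_arc_counts_def)
next
  case (3 m)
  have "3 * m + 2 + 1 = 3 * (m + 1)" by simp
  then have "line k r i (j + 1) = vtx k TV (i - m * r - r)"
    using line_simps(1)[of k r i "m + 1"] 3 by (simp add: algebra_simps)
  moreover have "j - 1 = 3 * m + 1" using 3 by simp
  then have "line k r i (j - 1) = vtx k TU (i - m * r)" "line k r i j = vtx k TW (i - m * r)"
    unfolding 3 by (simp_all only: line_simps)
  ultimately show ?thesis
    using assms by (auto simp: line_nbrs_def nbrs_T1 matched_arc_counts_def)
qed

text \<open>The types repeat with period 3 along a path, so positions two apart have different
  types. This gives a path a well-defined direction.\<close>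

lemma line_neq: "line k r i (j - 1) \<noteq> line k r i (j + 1)"
proof -
  have "(j - 1) mod 3 \<noteq> (j + 1) mod 3" by presburger
  moreover have "(j - 1) mod 3 \<in> {0, 1, 2}" "(j + 1) mod 3 \<in> {0, 1, 2}" by auto
  ultimately show ?thesis by (auto simp: line_def vtx_eq_iff)
qed

text \<open>The image of the first step fixes the direction \<open>e\<close>. Each further step is
  forced, as the image must leave a vertex by the 2-factor neighbour from which it did not come; the
  induction therefore carries two consecutive positions.\<close>

lemma pair_iso_line:
  assumes k: "k > 0" and m: "matched_arc_counts k r s \<alpha> \<beta>" "\<alpha> \<noteq> \<beta>"
    and f: "pair_iso f (T1 k r s) (T1 k r s)" and start: "f (line k r i j) = line k r i' j'"
  obtains e where "e = 1 \<or> e = -1" "\<And>n. f (line k r i (j + int n)) = line k r i' (j' + e * int n)"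
proof -
  have mem: "line k r i j \<in> pverts (T1 k r s)" for i j
    by (simp add: line_def vtx_in_T1[OF k])
  have wf: "pair_wf_digraph (T1 k r s)" by (rule pair_wf_T1[OF k])
  have im: "f ` {line k r i (j - 1), line k r i (j + 1)} = {line k r i' (j' - 1), line k r i' (j' + 1)}"
    if "f (line k r i j) = line k r i' j'" for j j'
  proof -
    have "f ` line_nbrs k r s \<beta> (line k r i j) = line_nbrs k r s \<beta> (f (line k r i j))"
      using nbrs_pair_iso[OF wf wf f mem] nbrs_subset[OF wf] arc_count_pair_iso[OF wf wf f mem]
      by (fastforce simp: line_nbrs_def)
    then show ?thesis by (simp only: that line_nbrs_line[OF k m])
  qed
  have inj: "f (line k r i (j - 1)) \<noteq> f (line k r i (j + 1))" for j
    using pair_iso_inj[OF f] mem line_neq by (meson inj_onD)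
  have "f (line k r i (j + 1)) \<in> {line k r i' (j' - 1), line k r i' (j' + 1)}"
    using im[OF start] by blast
  then obtain e where e: "e = 1 \<or> e = -1" "f (line k r i (j + 1)) = line k r i' (j' + e)"
    by (metis diff_conv_add_uminus empty_iff insert_iff)
  have "f (line k r i (j + int n)) = line k r i' (j' + e * int n) \<and>
    f (line k r i (j + int n + 1)) = line k r i' (j' + e * (int n + 1))" for n
  proof (induction n)
    case 0
    then show ?case using start e by simp
  next
    case (Suc n)
    let ?j = "j + int n + 1" and ?j' = "j' + e * (int n + 1)"
    have "{f (line k r i (?j - 1)), f (line k r i (?j + 1))} = {line k r i' (?j' - 1), line k r i' (?j' + 1)}"
      using im[of ?j ?j'] Suc by simp
    also have "\<dots> = {line k r i' (?j' - e), line k r i' (?j' + e)}"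
      using e(1) by auto
    finally have "f (line k r i (?j + 1)) = line k r i' (?j' + e)"
      using Suc inj[of ?j] by (auto simp: doubleton_eq_iff algebra_simps)
    then show ?case using Suc by (simp add: algebra_simps)
  qed
  then show ?thesis using that[of e] e(1) by blast
qed

section \<open>Mates in the perfect matching and the exclusion of two families\<close>

definition partner :: "nat \<Rightarrow> int \<Rightarrow> int \<Rightarrow> nat \<Rightarrow> t1_vertex \<Rightarrow> t1_vertex set" where
  "partner k r s \<alpha> x = {y \<in> nbrs (T1 k r s) x. arc_count (T1 k r s) 7 x y = \<alpha>}"

lemma partner_vtx:
  assumes "k > 0" "matched_arc_counts k r s \<alpha> \<beta>" "\<alpha> \<noteq> \<beta>"
  shows "partner k r s \<alpha> (vtx k TU i) = {vtx k TU (i + int k)}"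
    "partner k r s \<alpha> (vtx k TV i) = {vtx k TW (i + s)}"
    "partner k r s \<alpha> (vtx k TW i) = {vtx k TV (i - s)}"
  using assms by (auto simp: partner_def nbrs_T1 matched_arc_counts_def)

lemma partner_pair_iso:
  assumes "k > 0" "pair_iso f (T1 k r s) (T1 k r s)" "x \<in> pverts (T1 k r s)"
    "y \<in> partner k r s \<alpha> x"
  shows "f y \<in> partner k r s \<alpha> (f x)"
  using assms nbrs_pair_iso[OF pair_wf_T1[OF assms(1)] pair_wf_T1[OF assms(1)] assms(2,3)]
    nbrs_subset[OF pair_wf_T1[OF assms(1)], of r s x]
    arc_count_pair_iso[OF pair_wf_T1[OF assms(1)] pair_wf_T1[OF assms(1)] assms(2,3)]
  by (auto simp: partner_def)

lemma not_vertex_transitive_3r: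
  assumes "k \<ge> 9" "\<not> 2 * int k dvd r - s" "connected (with_proj (T1 k r s))" "2 * int k dvd 3 * r - s"
  shows "\<not> vertex_transitive (T1 k r s)"
proof
  assume "vertex_transitive (T1 k r s)"
  moreover have k: "k > 0" using assms(1) by simp
  ultimately obtain f where f: "pair_iso f (T1 k r s) (T1 k r s)" "f (vtx k TW 0) = vtx k TU 0"
    using vtx_in_T1[OF k] unfolding vertex_transitive_iff by blast
  note m = matched_arc_counts_3r[OF assms]
  have ne: "(4::nat) \<noteq> 6" by simp
  have "f (line k r 0 2) = line k r 0 1"
    using f(2) line_simps(3)[of k r 0 0] line_simps(2)[of k r 0 0] by simp
  then obtain e where e: "e = 1 \<or> e = -1" "\<And>n. f (line k r 0 (2 + int n)) = line k r 0 (1 + e * int n)"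
    using pair_iso_line[OF k m ne f(1)] by blast
  have "vtx k TV (- (3 * r)) = vtx k TV (0 - s)"
    using assms(4) dvd_minus_iff[of "2 * int k" "3 * r - s"] by (simp add: vtx_eq_iff)
  moreover have "line k r 0 9 = vtx k TV (- (3 * r))"
    using line_simps(1)[of k r 0 3] by simp
  ultimately have "line k r 0 9 \<in> partner k r s 4 (vtx k TW 0)"
    by (simp add: partner_vtx(3)[OF k m ne])
  then have "f (line k r 0 9) \<in> partner k r s 4 (vtx k TU 0)"
    using partner_pair_iso[OF k f(1) vtx_in_T1[OF k]] f(2) by metis
  then have "f (line k r 0 9) = vtx k TU (int k)"
    by (simp add: partner_vtx(1)[OF k m ne])
  moreover have "f (line k r 0 9) = line k r 0 (1 + e * 7)" using e(2)[of 7] by simp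
  \<comment> \<open>Seven steps from position 1 lead to positions 8 and -6, which carry the types
    \<open>TW\<close> and \<open>TV\<close>, whereas the mate of \<open>u_0\<close> has type
    \<open>TU\<close>.\<close>
  ultimately show False
    using e(1) by (auto simp: line_def vtx_eq_iff)
qed

lemma not_vertex_transitive_2r_odd:
  assumes "k \<ge> 9" "\<not> 2 * int k dvd r - s" "connected (with_proj (T1 k r s))"
    "2 * int k dvd 2 * r - 3 * s + int k" "odd r"
  shows "\<not> vertex_transitive (T1 k r s)"
proof
  assume "vertex_transitive (T1 k r s)"
  moreover have k: "k > 0" using assms(1) by simp
  ultimately obtain f where f: "pair_iso f (T1 k r s) (T1 k r s)" "f (vtx k TU 0) = vtx k TV 0"
    using vtx_in_T1[OF k] unfolding vertex_transitive_iff by blast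
  obtain \<alpha> \<beta> where m: "matched_arc_counts k r s \<alpha> \<beta>" "\<alpha> \<noteq> \<beta>"
    using matched_arc_counts_2r[OF assms(1-4)] that[of 5 4] that[of 6 5] by auto
  have "f (line k r 0 1) = line k r 0 0"
    using f(2) line_simps(2)[of k r 0 0] line_simps(1)[of k r 0 0] by simp
  then obtain e where e: "e = 1 \<or> e = -1" "\<And>n. f (line k r 0 (1 + int n)) = line k r 0 (0 + e * int n)"
    using pair_iso_line[OF k m f(1)] by metis
  \<comment> \<open>For odd \<open>r\<close>, \<open>- k r\<close> and \<open>k\<close> agree modulo
    \<open>2k\<close>, so the mate of \<open>u_0\<close> lies \<open>3k\<close> positions after
    it.\<close>
  have "vtx k TU (- (int k * r)) = vtx k TU (0 + int k)"
  proof -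
    obtain x where "r = 2 * x + 1" using assms(5) by (auto elim: oddE)
    then have "- (int k * r) - int k = 2 * int k * (- x - 1)" by (simp add: algebra_simps)
    then show ?thesis by (simp add: vtx_eq_iff)
  qed
  moreover have "line k r 0 (1 + int (3 * k)) = vtx k TU (- (int k * r))"
    using line_simps(2)[of k r 0 "int k"] by (simp add: add.commute)
  ultimately have "line k r 0 (1 + int (3 * k)) \<in> partner k r s \<alpha> (vtx k TU 0)"
    by (simp add: partner_vtx(1)[OF k m])
  then have "f (line k r 0 (1 + int (3 * k))) \<in> partner k r s \<alpha> (vtx k TV 0)"
    using partner_pair_iso[OF k f(1) vtx_in_T1[OF k]] f(2) by metis
  then have "f (line k r 0 (1 + int (3 * k))) = vtx k TW s"
    by (simp add: partner_vtx(2)[OF k m])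
  moreover have "f (line k r 0 (1 + int (3 * k))) = line k r 0 (3 * (e * int k))"
    using e(2)[of "3 * k"] by (simp add: algebra_simps)
  \<comment> \<open>Positions divisible by 3 carry the type \<open>TV\<close>, whereas the mate of
    \<open>v_0\<close> has type \<open>TW\<close>.\<close>
  ultimately show False
    by (simp add: line_simps vtx_eq_iff)
qed

section \<open>Isomorphisms between the graphs \<open>T1\<close>\<close>

lemma vtx_lift:
  assumes "\<And>t i j. 2 * int k dvd i - j \<Longrightarrow> F t i = F t j"
  obtains h where "\<And>t i. h (vtx k t i) = F t i"
proof -
  let ?h = "\<lambda>x. case x of vert_u i \<Rightarrow> F TU i | vert_v i \<Rightarrow> F TV i | vert_w i \<Rightarrow> F TW i"
  have "2 * int k dvd i mod (2 * int k) - i" for i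
    by (metis dvd_minus_mod dvd_diff_commute)
  then have "?h (vtx k t i) = F t i" for t i
    using assms by (cases t) (simp_all add: vtx.simps)
  then show ?thesis using that by blast
qed

lemma finite_T1: "finite (pverts (T1 k r s))"
  by (auto simp: T1_def Let_def)

text \<open>Maps are given on integer indices. Surjectivity follows by counting, since both graphs
  have \<open>6 * k\<close> vertices.\<close>

lemma T1_isoI:
  assumes k: "k > 0"
    and F: "\<And>t i t' j. vtx k t i = vtx k t' j \<longleftrightarrow> F t i = F t' j"
    and mem: "\<And>t i. F t i \<in> range (\<lambda>(t, i). vtx k t i)"
    and n: "\<And>t i. nbrs (T1 k r' s') (F t i) = (\<lambda>(t, i). F t i) ` {(t', j). vtx k t' j \<in> nbrs (T1 k r s) (vtx k t i)}"
  obtains h where "pair_iso h (T1 k r s) (T1 k r' s')" "\<And>t i. h (vtx k t i) = F t i"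
proof -
  obtain h where h: "\<And>t i. h (vtx k t i) = F t i"
    using vtx_lift[of k F] F by (metis vtx_eq_iff)
  have inj: "inj_on h (pverts (T1 k r s))"
  proof (rule inj_onI)
    fix x y assume "x \<in> pverts (T1 k r s)" "y \<in> pverts (T1 k r s)" "h x = h y"
    then show "x = y" using F h k by (metis T1_vertexE)
  qed
  have sub: "h ` pverts (T1 k r s) \<subseteq> pverts (T1 k r' s')"
    using h mem k by (auto simp: pverts_T1)
  have "h ` pverts (T1 k r s) = pverts (T1 k r' s')"
    using inj by (intro card_subset_eq[OF finite_T1 sub]) (simp add: card_image card_pverts_T1)
  then have "bij_betw h (pverts (T1 k r s)) (pverts (T1 k r' s'))" using inj by (simp add: bij_betw_def)
  moreover have "nbrs (T1 k r' s') (h x) = h ` nbrs (T1 k r s) x" if xV: "x \<in> pverts (T1 k r s)" for x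
  proof -
    obtain t i where x: "x = vtx k t i" using T1_vertexE[OF xV k] by blast
    have "nbrs (T1 k r s) x = (\<lambda>(t, i). vtx k t i) ` {(t', j). vtx k t' j \<in> nbrs (T1 k r s) x}"
    proof (intro equalityI subsetI)
      fix y assume y: "y \<in> nbrs (T1 k r s) x"
      then have "y \<in> pverts (T1 k r s)" using nbrs_subset[OF pair_wf_T1[OF k]] by blast
      then obtain t j where "y = vtx k t j" using T1_vertexE k by blast
      then show "y \<in> (\<lambda>(t, i). vtx k t i) ` {(t', j). vtx k t' j \<in> nbrs (T1 k r s) x}"
        using y by (auto intro!: image_eqI[of _ _ "(t, j)"])
    qed auto
    then have "h ` nbrs (T1 k r s) x = (\<lambda>p. h (case p of (t, i) \<Rightarrow> vtx k t i)) ` {(t', j). vtx k t' j \<in> nbrs (T1 k r s) x}"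
      by (metis image_image)
    also have "\<dots> = nbrs (T1 k r' s') (F t i)"
      unfolding n x using h by (intro image_cong) auto
    finally show ?thesis by (simp add: x h)
  qed
  ultimately have "pair_iso h (T1 k r s) (T1 k r' s')"
    by (intro pair_isoI_nbrs pair_wf_T1 k)
  then show ?thesis using that h by blast
qed

lemma T1_isoI_nbrs:
  assumes k: "k > 0"
    and F: "\<And>t i t' j. vtx k t i = vtx k t' j \<longleftrightarrow> F t i = F t' j"
    and mem: "\<And>t i. F t i \<in> range (\<lambda>(t, i). vtx k t i)"
    and "\<And>i. nbrs (T1 k r' s') (F TU i) = {F TU (i + int k), F TV i, F TW i}"
    and "\<And>i. nbrs (T1 k r' s') (F TV i) = {F TU i, F TW (i + r), F TW (i + s)}"
    and "\<And>i. nbrs (T1 k r' s') (F TW i) = {F TU i, F TV (i - r), F TV (i - s)}"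
  obtains h where "pair_iso h (T1 k r s) (T1 k r' s')" "\<And>t i. h (vtx k t i) = F t i"
proof (rule T1_isoI[OF k F mem])
  fix t i
  show "nbrs (T1 k r' s') (F t i) = (\<lambda>(t, i). F t i) ` {(t', j). vtx k t' j \<in> nbrs (T1 k r s) (vtx k t i)}"
    (is "_ = ?S t i")
  proof -
    have *: "F t' j \<in> ?S t i" if "vtx k t' j \<in> nbrs (T1 k r s) (vtx k t i)" for t' j
      using that by (auto intro!: image_eqI[of _ _ "(t', j)"])
    have "?S t i = (\<lambda>(t, i). F t i) ` {(t', j). \<exists>p\<in>(case t of TU \<Rightarrow> {(TU, i + int k), (TV, i), (TW, i)}
        | TV \<Rightarrow> {(TU, i), (TW, i + r), (TW, i + s)} | TW \<Rightarrow> {(TU, i), (TV, i - r), (TV, i - s)}).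
        vtx k t' j = vtx k (fst p) (snd p)}"
      by (cases t) (simp_all add: nbrs_T1[OF k])
    also have "\<dots> = (\<lambda>(t, i). F t i) ` (case t of TU \<Rightarrow> {(TU, i + int k), (TV, i), (TW, i)}
        | TV \<Rightarrow> {(TU, i), (TW, i + r), (TW, i + s)} | TW \<Rightarrow> {(TU, i), (TV, i - r), (TV, i - s)})"
      (is "_ = _ ` ?A")
    proof (intro equalityI subsetI)
      fix y assume "y \<in> (\<lambda>(t, i). F t i) ` {(t', j). \<exists>p\<in>?A. vtx k t' j = vtx k (fst p) (snd p)}"
      then obtain t' j p where "y = F t' j" "p \<in> ?A" "vtx k t' j = vtx k (fst p) (snd p)" by auto
      then show "y \<in> (\<lambda>(t, i). F t i) ` ?A" using F by (auto simp: case_prod_beta intro!: image_eqI[of _ _ p])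
    next
      fix y assume "y \<in> (\<lambda>(t, i). F t i) ` ?A"
      then obtain p where "p \<in> ?A" "y = F (fst p) (snd p)" by (auto simp: case_prod_beta)
      then show "y \<in> (\<lambda>(t, i). F t i) ` {(t', j). \<exists>p\<in>?A. vtx k t' j = vtx k (fst p) (snd p)}"
        by (auto simp: case_prod_beta intro!: image_eqI[of _ _ p] bexI[of _ p])
    qed
    finally show ?thesis using assms(4-6) by (cases t) simp_all
  qed
qed (use that in blast)

lemma T1_cong:
  assumes "k > 0" "2 * int k dvd r - r'" "2 * int k dvd s - s'"
  shows "T1 k r s = T1 k r' s'"
proof -
  have "vtx k TW (i + r) = vtx k TW (i + r')" "vtx k TW (i + s) = vtx k TW (i + s')" for i
    using assms by (simp_all add: vtx_eq_iff)
  then have "T1_edges k r s = T1_edges k r' s'" by (simp add: T1_edges_def)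
  then show ?thesis
    using assms(1) by (intro pair_pre_digraph.equality) (simp_all add: pverts_T1 parcs_T1)
qed

text \<open>All indices are multiplied by \<open>m\<close>. A unit modulo \<open>2k\<close> is odd,
  so \<open>m k\<close> and \<open>k\<close> agree modulo \<open>2k\<close> and the edges between
  \<open>u_i\<close> and \<open>u_(i+k)\<close> are respected.\<close>

lemma T1_mult_unit:
  assumes k: "k > 0" and m: "coprime m (2 * int k)"
  obtains h where "pair_iso h (T1 k r s) (T1 k (m * r) (m * s))"
proof (rule T1_isoI_nbrs[OF k, of "\<lambda>t i. vtx k t (m * i)" "m * r" "m * s" r s])
  have odd: "odd m" using m by (auto simp: coprime_commute)
  show "vtx k t i = vtx k t' j \<longleftrightarrow> vtx k t (m * i) = vtx k t' (m * j)" for t i t' j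
    using m by (simp add: vtx_eq_iff right_diff_distrib[symmetric] coprime_dvd_mult_right_iff coprime_commute)
  have "vtx k t (m * i + int k) = vtx k t (m * (i + int k))" for t i
  proof -
    obtain x where "m = 2 * x + 1" using odd by (auto elim: oddE)
    then have "m * i + int k - m * (i + int k) = 2 * int k * (- x)" by (simp add: algebra_simps)
    then show ?thesis by (simp add: vtx_eq_iff)
  qed
  then show "nbrs (T1 k (m * r) (m * s)) (vtx k TU (m * i)) = {vtx k TU (m * (i + int k)), vtx k TV (m * i), vtx k TW (m * i)}" for i
    by (simp add: nbrs_T1[OF k])
qed (use that in \<open>auto simp: nbrs_T1[OF k] algebra_simps\<close>)

text \<open>For odd \<open>k\<close> the congruence \<open>2r = 3 + k\<close> modulo
  \<open>2k\<close> has two solutions, which differ by the odd number \<open>k\<close>. The case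
  distinction on \<open>k mod 4\<close> picks the even one.\<close>

lemma r_star:
  assumes "odd k"
  shows "even (r_star k)" "2 * int k dvd 2 * r_star k - 3 + int k"
proof -
  let ?x = "if k mod 4 = 1 then (int k + 3) div 2 else (int k + 3) div 2 + int k"
  have x: "even ?x \<and> (2 * ?x = int k + 3 \<or> 2 * ?x = 3 * int k + 3)"
  proof (cases "k mod 4 = 1")
    case True
    then have "int k mod 4 = 1" by presburger
    then have "even ((int k + 3) div 2) \<and> 2 * ((int k + 3) div 2) = int k + 3" by presburger
    then show ?thesis using True by simp
  next
    case False
    then have "int k mod 4 = 3" using assms by presburger
    then have "even ((int k + 3) div 2 + int k) \<and> 2 * ((int k + 3) div 2 + int k) = 3 * int k + 3" by presburger
    then show ?thesis using False by simp
  qed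
  then have x2: "2 * int k dvd 2 * ?x - 3 + int k"
    by (elim conjE disjE) (auto intro: dvdI[of _ _ 1] dvdI[of _ _ 2])
  have r: "r_star k = ?x mod (2 * int k)" by (simp add: r_star_def)
  then have "2 * int k dvd ?x - r_star k" by (simp add: dvd_minus_mod)
  then obtain m where m: "?x - r_star k = 2 * int k * m" by (auto simp: dvd_def)
  have "even (?x - r_star k)" unfolding m by simp
  then show "even (r_star k)" using x by simp
  have "2 * r_star k - 3 + int k = (2 * ?x - 3 + int k) - 2 * int k * (2 * m)"
    using m by (simp add: algebra_simps)
  then show "2 * int k dvd 2 * r_star k - 3 + int k"
    using x2 by (metis dvd_diff dvd_triv_left)
qed

lemma T1_iso_X_graph:
  assumes k: "k > 0" and con: "connected (with_proj (T1 k r s))"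
    and rel: "2 * int k dvd 2 * r - 3 * s + int k" and r: "even r"
  obtains h where "odd k" "pair_iso h (T1 k r s) (X_graph k)"
proof -
  obtain x where x: "2 * r - 3 * s + int k = 2 * int k * x" using rel by (auto simp: dvd_def)
  have par: "even s \<longleftrightarrow> even k"
  proof -
    have "2 * (int k * x - r + s) = int k - s" using x by (simp add: algebra_simps)
    then have "even (int k - s)" by (metis dvd_triv_left)
    then show ?thesis by simp
  qed
  \<comment> \<open>Otherwise 2 would divide \<open>k\<close>, \<open>s\<close> and
    \<open>r\<close>.\<close>
  have "odd k"
    using T1_connected_common_divisor[OF k con, of 2] r par by auto
  then have "odd s" using par by simp
  have "coprime s (int k)"
  proof (rule coprimeI)
    fix d assume d: "d dvd s" "d dvd int k"
    have "2 * r = 3 * s - int k + 2 * int k * x" using x by simp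
    then have "d dvd 2 * r" using d by simp
    moreover have "odd d" using d(1) \<open>odd s\<close> by (meson dvd_trans)
    then have "coprime d 2" by simp
    ultimately have "d dvd r" by (simp add: coprime_dvd_mult_right_iff)
    then show "is_unit d" using T1_connected_common_divisor[OF k con d(2)] d(1) by simp
  qed
  then have cop: "coprime s (2 * int k)" using \<open>odd s\<close> by simp
  then obtain m v where "m * s + v * (2 * int k) = 1"
    using bezout_int[of s "2 * int k"] by (auto simp: coprime_iff_gcd_eq_1)
  then have "m * s - 1 = 2 * int k * (- v)" by (simp add: algebra_simps)
  then obtain z where z: "m * s - 1 = 2 * int k * z" by blast
  then have m: "2 * int k dvd m * s - 1" by simp
  have cm: "coprime m (2 * int k)"
  proof (rule coprimeI)
    fix d assume "d dvd m" "d dvd 2 * int k"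
    then have "d dvd m * s - 2 * int k * z" by simp
    then show "is_unit d" using z by (simp add: algebra_simps)
  qed
  \<comment> \<open>Both \<open>m r\<close> and \<open>r_star k\<close> solve the same congruence
    for their doubles, so they agree modulo the odd number \<open>k\<close>. Both are even, hence
    they agree modulo \<open>2k\<close>.\<close>
  have "2 * int k dvd m * r - r_star k"
  proof -
    obtain y where y: "2 * r_star k - 3 + int k = 2 * int k * y"
      using r_star(2)[OF \<open>odd k\<close>] by (auto simp: dvd_def)
    have r2: "2 * r = 3 * s - int k + 2 * int k * x" "2 * r_star k = 3 - int k + 2 * int k * y"
      using x y by simp_all
    have "2 * (m * r - r_star k) = m * (2 * r) - 2 * r_star k" by (simp add: algebra_simps)
    also have "\<dots> = m * (3 * s - int k + 2 * int k * x) - (3 - int k + 2 * int k * y)"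
      by (simp only: r2)
    also have "\<dots> = 3 * (m * s - 1) - m * int k + int k + 2 * int k * (m * x - y)"
      by (simp add: algebra_simps)
    also have "\<dots> = int k * (6 * z - m + 1 + 2 * (m * x - y))"
      unfolding z by (simp add: algebra_simps)
    finally have "int k dvd 2 * (m * r - r_star k)" by simp
    moreover have "coprime (int k) 2" using \<open>odd k\<close> by simp
    ultimately have "int k dvd m * r - r_star k"
      using coprime_dvd_mult_right_iff by blast
    then obtain q where q: "m * r - r_star k = int k * q" by (auto simp: dvd_def)
    have "even (m * r - r_star k)" using r r_star(1)[OF \<open>odd k\<close>] by simp
    then have "even q" unfolding q using \<open>odd k\<close> by simp
    then show ?thesis unfolding q by auto
  qed
  then have "T1 k (m * r) (m * s) = X_graph k"
    unfolding X_graph_def by (intro T1_cong k m)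
  then show ?thesis
    using T1_mult_unit[OF k cm, of r s] that \<open>odd k\<close> by metis
qed

section \<open>Vertex-transitivity of \<open>X_graph\<close>\<close>

lemma T1_translation:
  assumes k: "k > 0"
  obtains h where "pair_iso h (T1 k r s) (T1 k r s)" "\<And>t i. h (vtx k t i) = vtx k t (i + d)"
proof (rule T1_isoI_nbrs[OF k, of "\<lambda>t i. vtx k t (i + d)" r s r s])
qed (use that in \<open>auto simp: nbrs_T1[OF k] vtx_eq_iff algebra_simps\<close>)

text \<open>
  The extra automorphism shifts the paths through even indices one step forward and those through
  odd indices one step backward.
\<close>

fun twist :: "nat \<Rightarrow> int \<Rightarrow> vtype \<Rightarrow> int \<Rightarrow> t1_vertex" where
  "twist k r TU i = (if even i then vtx k TW (i + 1 + int k) else vtx k TV i)"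
| "twist k r TV i = (if even i then vtx k TU (i + 1 + int k) else vtx k TW (i + r))"
| "twist k r TW i = (if even i then vtx k TV (i + 1 + int k - r) else vtx k TU i)"

lemma T1_twist:
  assumes "odd k" "even r" and rel: "2 * int k dvd 2 * r - 3 + int k"
  obtains h where "pair_iso h (T1 k r 1) (T1 k r 1)" "\<And>t i. h (vtx k t i) = twist k r t i"
proof -
  have k: "k > 0" using assms(1) by (cases k) auto
  have par: "even i \<longleftrightarrow> even j" if ij: "2 * int k dvd i - j" for i j
  proof -
    obtain m where "i - j = 2 * int k * m" using ij by (auto simp: dvd_def)
    then have "even (i - j)" by simp
    then show ?thesis by simp
  qed
  \<comment> \<open>The relation enters through the edges between \<open>v_i\<close> and
    \<open>w_(i+1)\<close> with \<open>i\<close> odd: their ends go to \<open>w_(i+r)\<close> and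
    \<open>v_(i+2+k-r)\<close>, which must again be adjacent.\<close>
  have e1: "vtx k t (i + r - 1) = vtx k t (i + 2 + int k - r)" for t i
  proof -
    have "(i + r - 1) - (i + 2 + int k - r) = (2 * r - 3 + int k) - 2 * int k" by simp
    then have "2 * int k dvd (i + r - 1) - (i + 2 + int k - r)" using dvd_diff[OF rel dvd_refl] by (simp only:)
    then show ?thesis by (rule vtx_eqI)
  qed
  have e2: "vtx k t (i + 2 * int k) = vtx k t i" for t i by (simp add: vtx_eq_iff)
  have "vtx k t i = vtx k t' j \<longleftrightarrow> twist k r t i = twist k r t' j" for t i t' j
  proof
    assume "vtx k t i = vtx k t' j"
    then show "twist k r t i = twist k r t' j"
      using par[of i j] by (cases t; cases t') (auto simp: vtx_eq_iff)
  next
    assume *: "twist k r t i = twist k r t' j"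
    have "even i \<longleftrightarrow> even j"
      using * assms by (cases t; cases t') (auto simp: vtx_eq_iff dest!: par split: if_splits)
    then show "vtx k t i = vtx k t' j"
      using * by (cases t; cases t') (auto simp: vtx_eq_iff split: if_splits)
  qed
  moreover have "twist k r t i \<in> range (\<lambda>(t, i). vtx k t i)" for t i
    by (cases t) (auto intro: rev_image_eqI)
  moreover have "nbrs (T1 k r 1) (twist k r TU i) = {twist k r TU (i + int k), twist k r TV i, twist k r TW i}" for i
    using assms e2[of TW "i + 1"] by (auto simp: nbrs_T1[OF k] algebra_simps)
  moreover have "nbrs (T1 k r 1) (twist k r TV i) = {twist k r TU i, twist k r TW (i + r), twist k r TW (i + 1)}" for i
    using assms e2[of TU "i + 1"] e1[of TV i] by (auto simp: nbrs_T1[OF k] algebra_simps)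
  moreover have "nbrs (T1 k r 1) (twist k r TW i) = {twist k r TU i, twist k r TV (i - r), twist k r TV (i - 1)}" for i
    using assms e1[of TW i] by (auto simp: nbrs_T1[OF k] algebra_simps)
  ultimately show ?thesis
    using T1_isoI_nbrs[OF k, of "twist k r" r 1 r 1] that by blast
qed

text \<open>Translations act transitively on each type, and the twist takes \<open>u_1\<close> to
  \<open>v_1\<close> and \<open>u_0\<close> to \<open>w_(k+1)\<close>.\<close>

lemma vertex_transitive_X_graph:
  assumes "odd k"
  shows "vertex_transitive (X_graph k)"
proof -
  have k: "k > 0" using assms by (cases k) auto
  let ?r = "r_star k"
  let ?G = "T1 k ?r 1"
  obtain h where h: "pair_iso h ?G ?G" "\<And>t i. h (vtx k t i) = twist k ?r t i"
    using T1_twist[OF assms r_star[OF assms]] by metis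
  have reach: "\<exists>f. pair_iso f ?G ?G \<and> f (vtx k TU 0) = vtx k t i" for t i
  proof -
    have tr: "\<exists>f. pair_iso f ?G ?G \<and> f (vtx k t i) = vtx k t j" for t i j
      using T1_translation[OF k, of ?r 1 "j - i"] by (metis add_diff_cancel_left' diff_add_cancel add.commute)
    have step: "\<exists>f. pair_iso f ?G ?G \<and> f x = z"
      if "\<exists>f. pair_iso f ?G ?G \<and> f x = y" "\<exists>f. pair_iso f ?G ?G \<and> f y = z" for x y z
      using that by (metis comp_apply pair_iso_comp)
    have v: "\<exists>f. pair_iso f ?G ?G \<and> f (vtx k TU 1) = vtx k TV 1"
      using h by (metis odd_one twist.simps(1))
    have w: "\<exists>f. pair_iso f ?G ?G \<and> f (vtx k TU 0) = vtx k TW (0 + 1 + int k)"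
      using h by (metis even_zero twist.simps(1))
    show ?thesis
    proof (cases t)
      case TU then show ?thesis using tr by blast
    next
      case TV then show ?thesis using step[OF step[OF tr v] tr] by blast
    next
      case TW then show ?thesis using step[OF w tr] by blast
    qed
  qed
  have "vertex_transitive ?G"
    unfolding vertex_transitive_iff
  proof (intro ballI)
    fix x y assume xy: "x \<in> pverts ?G" "y \<in> pverts ?G"
    obtain f where f: "pair_iso f ?G ?G" "f (vtx k TU 0) = x" using reach T1_vertexE[OF xy(1) k] by metis
    obtain g where g: "pair_iso g ?G ?G" "g (vtx k TU 0) = y" using reach T1_vertexE[OF xy(2) k] by metis
    have "pair_iso (g \<circ> inv_into (pverts ?G) f) ?G ?G"
      by (rule pair_iso_comp[OF pair_iso_inv_into[OF f(1)] g(1)])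
    moreover have "(g \<circ> inv_into (pverts ?G) f) x = y"
      using f g pair_iso_inj[OF f(1)] vtx_in_T1[OF k, of TU 0 ?r 1] by auto
    ultimately show "\<exists>f. pair_iso f ?G ?G \<and> f x = y" by blast
  qed
  then show ?thesis by (simp add: X_graph_def)
qed

section \<open>Generalized Petersen graphs\<close>

definition gvtx :: "nat \<Rightarrow> bool \<Rightarrow> int \<Rightarrow> gp_vertex" where
  "gvtx n b j = (if b then vert_a else vert_b) (j mod int n)"

lemma gvtx_eq_iff: "gvtx n b i = gvtx n b' j \<longleftrightarrow> b = b' \<and> int n dvd i - j"
  by (auto simp: gvtx_def mod_eq_dvd_iff)

lemma pverts_GP:
  assumes "n > 0"
  shows "pverts (GP n t) = range (\<lambda>(b, j). gvtx n b j)"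
proof -
  have "range (\<lambda>(b, j). gvtx n b j) = range (gvtx n True) \<union> range (gvtx n False)"
    by (auto simp: image_iff) (metis (full_types))
  also have "\<dots> = vert_a ` range (\<lambda>j. j mod int n) \<union> vert_b ` range (\<lambda>j. j mod int n)"
    by (auto simp: gvtx_def)
  finally show ?thesis
    using assms by (simp add: range_mod_int GP_def Let_def)
qed

lemma card_pverts_GP: "card (pverts (GP n t)) = 2 * n"
proof -
  let ?Z = "{0..<int n}"
  have "card (vert_a ` ?Z \<union> vert_b ` ?Z) = card (vert_a ` ?Z) + card (vert_b ` ?Z)"
    by (rule card_Un_disjoint) auto
  then show ?thesis by (simp add: GP_def Let_def card_image inj_on_def)
qed

lemma finite_GP: "finite (pverts (GP n t))"
  by (simp add: GP_def Let_def)

definition GP_edges :: "nat \<Rightarrow> int \<Rightarrow> (gp_vertex \<times> gp_vertex) set" where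
  "GP_edges n t = (\<Union>i. {(gvtx n True i, gvtx n True (i + 1)), (gvtx n True i, gvtx n False i),
     (gvtx n False i, gvtx n False (i + t))})"

lemma parcs_GP:
  assumes "n > 0"
  shows "parcs (GP n t) = GP_edges n t \<union> (GP_edges n t)\<inverse>"
proof -
  let ?e = "\<lambda>i. {(vert_a i, vert_a ((i + 1) mod int n)), (vert_a i, vert_b i),
                 (vert_b i, vert_b ((i + t) mod int n))}"
  have "GP_edges n t = (\<Union>i. ?e (i mod int n))"
    by (simp add: GP_edges_def mod_add_left_eq gvtx_def)
  also have "\<dots> = (\<Union>i\<in>{0..<int n}. ?e i)"
    using range_mod_int[of "int n"] assms by (metis (no_types, lifting) SUP_cong image_image of_nat_0_less_iff)
  finally show ?thesis
    by (auto simp: GP_def Let_def mk_symmetric_def)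
qed

lemma gvtx_in_GP: "n > 0 \<Longrightarrow> gvtx n b j \<in> pverts (GP n t)"
  by (auto simp: pverts_GP)

lemma GP_vertexE:
  assumes "x \<in> pverts (GP n t)" "n > 0"
  obtains b j where "x = gvtx n b j"
  using assms by (auto simp: pverts_GP)

lemma pair_wf_GP: "n > 0 \<Longrightarrow> pair_wf_digraph (GP n t)"
  by unfold_locales (auto simp: parcs_GP GP_edges_def gvtx_in_GP)

lemma nbrs_GP_iff:
  assumes "n > 0"
  shows "gvtx n b' j \<in> nbrs (GP n t) (gvtx n b i) \<longleftrightarrow>
    (if b \<noteq> b' then int n dvd j - i
     else int n dvd j - i - (if b then 1 else t) \<or> int n dvd j - i + (if b then 1 else t))"
proof -
  have e: "(gvtx n b i, gvtx n b' j) \<in> GP_edges n t \<longleftrightarrow>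
    (if b = b' then int n dvd j - i - (if b then 1 else t) else b \<and> int n dvd j - i)" for b i b' j
  proof -
    have 1: "(\<exists>l. gvtx n b i = gvtx n c l \<and> gvtx n b' j = gvtx n c' (l + d)) \<longleftrightarrow>
      b = c \<and> b' = c' \<and> int n dvd j - i - d" for c c' d
    proof
      assume "\<exists>l. gvtx n b i = gvtx n c l \<and> gvtx n b' j = gvtx n c' (l + d)"
      then obtain l where l: "b = c" "b' = c'" "int n dvd i - l" "int n dvd j - (l + d)"
        by (auto simp: gvtx_eq_iff)
      have "j - i - d = (j - (l + d)) - (i - l)" by simp
      then have "int n dvd j - i - d" using dvd_diff[OF l(4,3)] by presburger
      then show "b = c \<and> b' = c' \<and> int n dvd j - i - d" using l by blast
    next
      assume "b = c \<and> b' = c' \<and> int n dvd j - i - d"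
      then show "\<exists>l. gvtx n b i = gvtx n c l \<and> gvtx n b' j = gvtx n c' (l + d)"
        by (intro exI[of _ i]) (simp add: gvtx_eq_iff algebra_simps)
    qed
    show ?thesis
      using 1[of True True 1] 1[of True False 0] 1[of False False t]
      by (cases b; cases b') (auto simp: GP_edges_def)
  qed
  have m: "int n dvd i - j - d \<longleftrightarrow> int n dvd j - i + d" for d
    using dvd_minus_iff[of "int n" "j - i + d"] by (simp add: algebra_simps)
  show ?thesis
    using e[of b i b' j] e[of b' j b i] m[of 1] m[of t] m[of 0] assms
    by (cases b; cases b') (auto simp: nbrs_def parcs_GP)
qed

lemma nbrs_GP:
  assumes "n > 0"
  shows "nbrs (GP n t) (gvtx n True j) = {gvtx n True (j + 1), gvtx n True (j - 1), gvtx n False j}"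
    and "nbrs (GP n t) (gvtx n False j) = {gvtx n True j, gvtx n False (j + t), gvtx n False (j - t)}"
proof -
  have *: "nbrs (GP n t) (gvtx n b i) = X" if X: "\<And>x. x \<in> X \<Longrightarrow> \<exists>b j. x = gvtx n b j"
    and eq: "\<And>b' j. gvtx n b' j \<in> nbrs (GP n t) (gvtx n b i) \<longleftrightarrow> gvtx n b' j \<in> X" for b i X
  proof (intro equalityI subsetI)
    fix x assume x: "x \<in> nbrs (GP n t) (gvtx n b i)"
    then have "x \<in> pverts (GP n t)" using nbrs_subset[OF pair_wf_GP[OF assms]] by blast
    then obtain b' j where "x = gvtx n b' j" using assms by (rule GP_vertexE)
    then show "x \<in> X" using x eq by simp
  next
    fix x assume x: "x \<in> X"
    then obtain b' j where "x = gvtx n b' j" using X by blast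
    then show "x \<in> nbrs (GP n t) (gvtx n b i)" using x eq by simp
  qed
  note simps = nbrs_GP_iff[OF assms] gvtx_eq_iff diff_diff_eq diff_diff_eq2 diff_add_eq insert_iff empty_iff
  show "nbrs (GP n t) (gvtx n True j) = {gvtx n True (j + 1), gvtx n True (j - 1), gvtx n False j}"
  proof (rule *)
    fix b' l show "gvtx n b' l \<in> nbrs (GP n t) (gvtx n True j) \<longleftrightarrow>
      gvtx n b' l \<in> {gvtx n True (j + 1), gvtx n True (j - 1), gvtx n False j}"
      by (cases b') (simp_all add: simps)
  qed blast
  show "nbrs (GP n t) (gvtx n False j) = {gvtx n True j, gvtx n False (j + t), gvtx n False (j - t)}"
  proof (rule *)
    fix b' l show "gvtx n b' l \<in> nbrs (GP n t) (gvtx n False j) \<longleftrightarrow>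
      gvtx n b' l \<in> {gvtx n True j, gvtx n False (j + t), gvtx n False (j - t)}"
      by (cases b') (simp_all add: simps)
  qed blast
qed

lemma gvtx_lift:
  assumes "\<And>b i j. int n dvd i - j \<Longrightarrow> F b i = F b j"
  obtains h where "\<And>b i. h (gvtx n b i) = F b i"
proof -
  let ?h = "\<lambda>x. case x of vert_a i \<Rightarrow> F True i | vert_b i \<Rightarrow> F False i"
  have "int n dvd i mod int n - i" for i
    by (metis dvd_minus_mod dvd_diff_commute)
  then have "?h (gvtx n b i) = F b i" for b i
    using assms by (cases b) (simp_all add: gvtx_def)
  then show ?thesis using that by blast
qed

lemma GP_rotation:
  assumes n: "n > 0"
  obtains h where "pair_iso h (GP n t) (GP n t)" "\<And>b j. h (gvtx n b j) = gvtx n b (j + 1)"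
proof -
  obtain h where h: "\<And>b j. h (gvtx n b j) = gvtx n b (j + 1)"
    using gvtx_lift[of n "\<lambda>b j. gvtx n b (j + 1)"] by (auto simp: gvtx_eq_iff)
  have "inj_on h (pverts (GP n t))"
    using n by (auto simp: inj_on_def pverts_GP h gvtx_eq_iff)
  moreover have "h ` pverts (GP n t) \<subseteq> pverts (GP n t)"
    using n gvtx_in_GP[OF n] by (auto simp: h elim: GP_vertexE)
  ultimately have "bij_betw h (pverts (GP n t)) (pverts (GP n t))"
    using finite_GP by (simp add: bij_betw_def endo_inj_surj)
  moreover have "nbrs (GP n t) (h x) = h ` nbrs (GP n t) x" if "x \<in> pverts (GP n t)" for x
  proof -
    have "nbrs (GP n t) (h (gvtx n b j)) = h ` nbrs (GP n t) (gvtx n b j)" for b j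
      by (cases b) (simp_all add: h nbrs_GP[OF n] algebra_simps)
    then show ?thesis using GP_vertexE[OF that n] by metis
  qed
  ultimately have "pair_iso h (GP n t) (GP n t)" by (intro pair_isoI_nbrs pair_wf_GP n)
  then show ?thesis using that h by blast
qed

text \<open>The outer rim of the Petersen graph becomes the path through even indices.\<close>

definition gp_image :: "nat \<Rightarrow> int \<Rightarrow> bool \<Rightarrow> int \<Rightarrow> t1_vertex" where
  "gp_image k r b j = (if b then line k r 0 j
     else if j mod 3 = 0 then vtx k TW (1 - (j div 3) * r)
     else if j mod 3 = 1 then vtx k TU (int k - (j div 3) * r)
     else vtx k TV (- 1 - (j div 3) * r))"

text \<open>The image of \<open>b_j\<close> is the mate of the image of \<open>a_j\<close> in the
  perfect matching, so spokes become matching edges.\<close>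

lemma gp_image_simps:
  "gp_image k r True (3 * m) = vtx k TV (- (m * r))"
  "gp_image k r True (3 * m + 1) = vtx k TU (- (m * r))"
  "gp_image k r True (3 * m + 2) = vtx k TW (- (m * r))"
  "gp_image k r False (3 * m) = vtx k TW (1 - m * r)"
  "gp_image k r False (3 * m + 1) = vtx k TU (int k - m * r)"
  "gp_image k r False (3 * m + 2) = vtx k TV (- 1 - m * r)"
  by (simp_all add: gp_image_def line_def)

text \<open>Advancing by \<open>3k\<close> positions changes the index by \<open>k r\<close>, a
  multiple of \<open>2k\<close> because \<open>r\<close> is even.\<close>

lemma gp_image_cong:
  assumes "even r" "int (3 * k) dvd i - j"
  shows "gp_image k r b i = gp_image k r b j"
proof -
  obtain q where q: "i = j + 3 * (int k * q)" using assms(2) by (auto simp: dvd_def algebra_simps)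
  have d: "i mod 3 = j mod 3" "i div 3 = j div 3 + int k * q" unfolding q by simp_all
  obtain z where z: "r = 2 * z" using assms(1) by blast
  have v: "vtx k t (x - (i div 3) * r) = vtx k t (x - (j div 3) * r)" for t x
    unfolding vtx_eq_iff d z by (intro conjI refl dvdI[of _ _ "- (q * z)"]) (simp add: algebra_simps)
  show ?thesis using v v[of _ 0] by (simp add: gp_image_def line_def d(1))
qed

text \<open>When \<open>b_j\<close> moves one step along its own path, its mate moves
  \<open>3c + 2\<close> positions along the outer one, where \<open>3c + 2\<close> is
  \<open>1 + k\<close> or \<open>1 - k\<close>. This is the Petersen parameter up to sign.\<close>

lemma GP_iso_T1:
  assumes k: "odd k" and r: "even r" and rel: "2 * int k dvd 2 * r - 3 + int k"
    and con: "connected (with_proj (T1 k r 1))"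
    and c: "3 * c + 1 = int k \<or> 3 * c + 1 = - int k" and t: "t = 3 * c + 2 \<or> t = - (3 * c + 2)"
  obtains h where "pair_iso h (GP (3 * k) t) (T1 k r 1)"
proof -
  have k0: "k > 0" using k by (cases k) auto
  then have n: "3 * k > 0" by simp
  obtain x where x: "2 * r = 3 - int k + 2 * (int k * x)"
    using rel by (auto simp: dvd_def algebra_simps)
  obtain z where z: "r = 2 * z" using r by blast
  have "\<exists>y. c * r = 1 - r + int k + 2 * (int k * y)"
  proof -
    define y where "y = c * r - 1 + r - int k"
    obtain \<epsilon> where e: "3 * c + 1 = \<epsilon> * int k" using c by (metis mult_1 mult_minus1)
    have "even (int k + 1)" using k by simp
    then obtain w where w: "int k = 2 * w - 1" by (metis add_diff_cancel_right' evenE)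
    have y2: "y = 2 * (c * z - w + z)" unfolding y_def z w by (simp add: algebra_simps)
    have "3 * y = (3 * c + 1) * r + (2 * r - 3 + int k) - 4 * int k"
      unfolding y_def by (simp add: algebra_simps)
    also have "\<dots> = 2 * int k * (\<epsilon> * z + x - 2)"
      unfolding e x by (simp add: z algebra_simps)
    finally have y3: "3 * y = 2 * int k * (\<epsilon> * z + x - 2)" .
    \<comment> \<open>Both summands are multiples of \<open>2k\<close>: the first since
      \<open>3c + 1\<close> is \<open>k\<close> or \<open>- k\<close> and \<open>y\<close> is even,
      the second by \<open>y3\<close>.\<close>
    have "y = (3 * c + 1) * y - c * (3 * y)" by (simp add: algebra_simps)
    also have "\<dots> = 2 * int k * (\<epsilon> * (c * z - w + z) - c * (\<epsilon> * z + x - 2))"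
      unfolding e y3 by (subst y2) (simp add: algebra_simps)
    finally obtain q where "y = 2 * int k * q" by blast
    then show ?thesis unfolding y_def by (intro exI[of _ q]) (simp add: algebra_simps)
  qed
  then obtain y where y: "c * r = 1 - r + int k + 2 * (int k * y)" by blast
  let ?F = "gp_image k r"
  obtain h where h: "\<And>b j. h (gvtx (3 * k) b j) = ?F b j"
    using gvtx_lift[of "3 * k" ?F] gp_image_cong[OF r] by metis
  have N: "nbrs (T1 k r 1) (?F True j) = {?F True (j + 1), ?F True (j - 1), ?F False j}
    \<and> nbrs (T1 k r 1) (?F False j) = {?F True j, ?F False (j + (3 * c + 2)), ?F False (j - (3 * c + 2))}" for j
  proof (cases j rule: int_mod3_cases)
    case (1 m)
    have s: "?F b (j + 1) = ?F b (3 * m + 1)" "?F b (j - 1) = ?F b (3 * (m - 1) + 2)" 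
      "?F b (j + (3 * c + 2)) = ?F b (3 * (m + c) + 2)" "?F b (j - (3 * c + 2)) = ?F b (3 * (m - c - 1) + 1)" for b
      by (simp_all add: 1 algebra_simps)
    \<comment> \<open>This quotient and the similar ones below come from substituting the formulas
      for \<open>2 * r\<close> and \<open>c * r\<close>, which involve \<open>x\<close> and
      \<open>y\<close>.\<close>
    have "vtx k TV (- 1 - (m + c) * r) = vtx k TV (1 - m * r - r)"
      by (intro vtx_eqI dvdI[of _ _ "x - y - 1"]) (use x y in \<open>simp add: algebra_simps\<close>)
    moreover have "vtx k TU (int k - (m - c - 1) * r) = vtx k TU (1 - m * r)"
      by (intro vtx_eqI dvdI[of _ _ "y + 1"]) (use x y in \<open>simp add: algebra_simps\<close>)
    ultimately show ?thesis
      unfolding s unfolding 1 gp_image_simps nbrs_T1[OF k0] by (auto simp: algebra_simps)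
  next
    case (2 m)
    have s: "?F b (j + 1) = ?F b (3 * m + 2)" "?F b (j - 1) = ?F b (3 * m)" 
      "?F b (j + (3 * c + 2)) = ?F b (3 * (m + c + 1))" "?F b (j - (3 * c + 2)) = ?F b (3 * (m - c - 1) + 2)" for b
      by (simp_all add: 2 algebra_simps)
    have "vtx k TW (1 - (m + c + 1) * r) = vtx k TW (int k - m * r)"
      by (intro vtx_eqI dvdI[of _ _ "- y - 1"]) (use x y in \<open>simp add: algebra_simps\<close>)
    moreover have "vtx k TV (- 1 - (m - c - 1) * r) = vtx k TV (int k - m * r)"
      by (intro vtx_eqI dvdI[of _ _ "y"]) (use x y in \<open>simp add: algebra_simps\<close>)
    moreover have "vtx k TU (int k - m * r + int k) = vtx k TU (- (m * r))"
      by (simp add: vtx_eq_iff)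
    ultimately show ?thesis
      unfolding s unfolding 2 gp_image_simps nbrs_T1[OF k0] by (auto simp: algebra_simps)
  next
    case (3 m)
    have s: "?F b (j + 1) = ?F b (3 * (m + 1))" "?F b (j - 1) = ?F b (3 * m + 1)" 
      "?F b (j + (3 * c + 2)) = ?F b (3 * (m + c + 1) + 1)" "?F b (j - (3 * c + 2)) = ?F b (3 * (m - c))" for b
      by (simp_all add: 3 algebra_simps)
    have "vtx k TU (int k - (m + c + 1) * r) = vtx k TU (- 1 - m * r)"
      by (intro vtx_eqI dvdI[of _ _ "- y"]) (use x y in \<open>simp add: algebra_simps\<close>)
    moreover have "vtx k TW (1 - (m - c) * r) = vtx k TW (- 1 - m * r + r)"
      by (intro vtx_eqI dvdI[of _ _ "y - x + 1"]) (use x y in \<open>simp add: algebra_simps\<close>)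
    ultimately show ?thesis
      unfolding s unfolding 3 gp_image_simps nbrs_T1[OF k0] by (auto simp: algebra_simps minus_diff_commute)
  qed
  \<comment> \<open>Naming the step length lets both signs of \<open>t\<close> be treated alike:
    \<open>t\<close> and \<open>- t\<close> give the same inner neighbours.\<close>
  define d where "d = 3 * c + 2"
  have nb: "nbrs (T1 k r 1) (h v) = h ` nbrs (GP (3 * k) t) v" if v: "v \<in> pverts (GP (3 * k) t)" for v
  proof -
    obtain b j where "v = gvtx (3 * k) b j" using GP_vertexE[OF v n] by blast
    then show ?thesis
      using N[of j] t unfolding d_def[symmetric] by (cases b) (auto simp: h nbrs_GP[OF n])
  qed
  have sub: "h ` pverts (GP (3 * k) t) \<subseteq> pverts (T1 k r 1)"
    using vtx_in_T1[OF k0] by (auto simp: pverts_GP[OF n] h gp_image_def line_def)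
  \<comment> \<open>The image is closed under adjacency, so it is everything by connectedness.
    Injectivity then follows because both graphs have \<open>6 * k\<close> vertices.\<close>
  have im: "h ` pverts (GP (3 * k) t) = pverts (T1 k r 1)"
  proof
    let ?I = "h ` pverts (GP (3 * k) t)"
    have step: "b \<in> ?I" if ab: "(a, b) \<in> parcs (T1 k r 1)" "a \<in> ?I" for a b
    proof -
      obtain v where v: "v \<in> pverts (GP (3 * k) t)" "a = h v" using ab(2) by blast
      then have "b \<in> h ` nbrs (GP (3 * k) t) v" using nb[OF v(1)] ab(1) by (auto simp: nbrs_def)
      then show ?thesis using nbrs_subset[OF pair_wf_GP[OF n]] by blast
    qed
    have sym: "(b, a) \<in> parcs (T1 k r 1)" if "(a, b) \<in> parcs (T1 k r 1)" for a b
      using that by (auto simp: parcs_T1[OF k0])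
    show "pverts (T1 k r 1) \<subseteq> ?I"
    proof (rule connected_closed_subset[OF con])
      show "h (gvtx (3 * k) True 0) \<in> ?I" using gvtx_in_GP[OF n] by blast
      then show "h (gvtx (3 * k) True 0) \<in> pverts (T1 k r 1)" using sub by blast
      show "a \<in> ?I \<longleftrightarrow> b \<in> ?I" if "(a, b) \<in> parcs (T1 k r 1)" for a b
        using step that sym by blast
    qed
  qed (fact sub)
  moreover have "inj_on h (pverts (GP (3 * k) t))"
    by (rule eq_card_imp_inj_on[OF finite_GP]) (simp add: im card_pverts_T1 card_pverts_GP)
  ultimately have "bij_betw h (pverts (GP (3 * k) t)) (pverts (T1 k r 1))"
    by (simp add: bij_betw_def)
  then have "pair_iso h (GP (3 * k) t) (T1 k r 1)"
    using nb by (intro pair_isoI_nbrs pair_wf_GP n)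
  then show ?thesis using that by blast
qed

text \<open>The rotation of the Petersen graph, transported by \<open>h\<close>, generates a cyclic
  group whose two orbits are the images of the rims, of size \<open>n\<close> each.\<close>

lemma bicirculant_if_GP_iso:
  assumes con: "connected (with_proj G)" and n: "n > 1" and h: "pair_iso h (GP n t) G"
  shows "bicirculant G"
proof -
  have n0: "n > 0" using n by simp
  let ?V = "pverts G" and ?A = "aut_group G"
  obtain f where f: "pair_iso f (GP n t) (GP n t)" "\<And>b j. f (gvtx n b j) = gvtx n b (j + 1)"
    using GP_rotation[OF n0] by blast
  \<comment> \<open>Restricted because the elements of \<open>aut_group\<close> are
    extensional.\<close>
  define R where "R = restrict (h \<circ> (f \<circ> inv_into (pverts (GP n t)) h)) ?V"
  define e where "e b j = h (gvtx n b j)" for b j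
  have V: "?V = range (e True) \<union> range (e False)"
  proof -
    have "?V = h ` pverts (GP n t)" using h by (auto simp: pair_iso_def bij_betw_def)
    then show ?thesis by (auto simp: pverts_GP[OF n0] e_def image_iff) (metis (full_types))
  qed
  have eV: "e b j \<in> ?V" for b j unfolding V by (cases b) auto
  have e_eq: "e b i = e b' j \<longleftrightarrow> b = b' \<and> int n dvd i - j" for b b' i j
    using inj_onD[OF pair_iso_inj[OF h]] gvtx_in_GP[OF n0] gvtx_eq_iff unfolding e_def by metis
  interpret group_action ?A ?V "\<lambda>f. f" by (rule group_action_aut_group)
  interpret A: group ?A using group_hom by (rule group_hom.axioms)
  have "pair_iso (h \<circ> (f \<circ> inv_into (pverts (GP n t)) h)) G G"
    by (rule pair_iso_comp[OF pair_iso_comp[OF pair_iso_inv_into[OF h] f(1)] h])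
  then have R: "R \<in> carrier ?A" unfolding R_def by (rule restrict_pair_iso_in_aut_group)
  have Re: "R (e b j) = e b (j + 1)" for b j
    using eV[of b j] pair_iso_inj[OF h] gvtx_in_GP[OF n0] by (simp add: R_def e_def f(2))
  have pow_nat: "(R [^]\<^bsub>?A\<^esub> m) (e b j) = e b (j + int m)" for m :: nat and b j
  proof (induction m arbitrary: j)
    case 0
    then show ?case using id_eq_one eV by (metis A.nat_pow_0 add.right_neutral of_nat_0 restrict_apply')
  next
    case (Suc m)
    have "(R [^]\<^bsub>?A\<^esub> Suc m) (e b j) = (R [^]\<^bsub>?A\<^esub> m) (R (e b j))"
      using composition_rule[OF eV A.nat_pow_closed[OF R] R] by simp
    then show ?case using Suc[of "j + 1"] by (simp add: Re algebra_simps)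
  qed
  have pow_int: "(R [^]\<^bsub>?A\<^esub> m) (e b j) = e b (j + m)" for m :: int and b j
  proof (cases m rule: int_cases2)
    case (nonneg l)
    then show ?thesis by (simp add: int_pow_int pow_nat)
  next
    case (nonpos l)
    have "(inv\<^bsub>?A\<^esub> (R [^]\<^bsub>?A\<^esub> l)) (e b j) = e b (j - int l)"
      by (rule orbit_sym_aux[OF A.nat_pow_closed[OF R] eV]) (simp add: pow_nat)
    then show ?thesis using nonpos R by (simp add: A.int_pow_neg_int)
  qed
  define H where "H = generate ?A {R}"
  have sub: "subgroup H ?A" unfolding H_def using R by (intro A.generate_is_subgroup) auto
  have HA: "?A\<lparr>carrier := H\<rparr> = subgroup_generated ?A {R}"
    using R by (simp add: H_def subgroup_generated_def)
  then have cyc: "cyclic_group (?A\<lparr>carrier := H\<rparr>)" by (simp add: A.cyclic_group_generated)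
  have "carrier (?A\<lparr>carrier := H\<rparr>) = range (\<lambda>m::int. R [^]\<^bsub>?A\<^esub> m)"
    unfolding HA by (rule A.carrier_subgroup_generated_by_singleton[OF R])
  then have H: "H = range (\<lambda>m::int. R [^]\<^bsub>?A\<^esub> m)" by simp
  have orb: "Group_Action.orbit (?A\<lparr>carrier := H\<rparr>) (\<lambda>f. f) (e b j) = range (e b)" for b j
  proof -
    have "Group_Action.orbit (?A\<lparr>carrier := H\<rparr>) (\<lambda>f. f) (e b j) = range (\<lambda>m::int. e b (j + m))"
      unfolding Group_Action.orbit_def by (auto simp: H pow_int[symmetric])
    also have "\<dots> = e b ` range ((+) j)" by (simp only: image_image)
    also have "range ((+) j) = UNIV" by (rule surj_plus)
    finally show ?thesis .
  qed
  have orbs: "orbits (?A\<lparr>carrier := H\<rparr>) ?V (\<lambda>f. f) = {range (e True), range (e False)}"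
  proof (intro equalityI subsetI)
    fix B assume "B \<in> orbits (?A\<lparr>carrier := H\<rparr>) ?V (\<lambda>f. f)"
    then obtain b j where "B = Group_Action.orbit (?A\<lparr>carrier := H\<rparr>) (\<lambda>f. f) (e b j)"
      by (auto simp: orbits_def V)
    then show "B \<in> {range (e True), range (e False)}" unfolding orb by (cases b) auto
  next
    fix B assume "B \<in> {range (e True), range (e False)}"
    then obtain b where "B = Group_Action.orbit (?A\<lparr>carrier := H\<rparr>) (\<lambda>f. f) (e b 0)"
      unfolding orb by blast
    then show "B \<in> orbits (?A\<lparr>carrier := H\<rparr>) ?V (\<lambda>f. f)"
      using eV by (auto simp: orbits_def)
  qed
  have card: "card (range (e b)) = n" for b
  proof -
    have "range (e b) = e b ` {0..<int n}"
    proof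
      show "range (e b) \<subseteq> e b ` {0..<int n}"
      proof safe
        fix j
        have "int n dvd j - j mod int n" by (rule dvd_minus_mod)
        then have "e b j = e b (j mod int n)" by (simp add: e_eq)
        then show "e b j \<in> e b ` {0..<int n}" using n0 by auto
      qed
    qed auto
    moreover have "inj_on (e b) {0..<int n}"
    proof (rule inj_onI)
      fix i j assume ij: "i \<in> {0..<int n}" "j \<in> {0..<int n}" "e b i = e b j"
      then have "i mod int n = j mod int n" by (simp only: e_eq mod_eq_dvd_iff)
      then show "i = j" using ij(1,2) by (metis atLeastLessThan_iff mod_pos_pos_trivial)
    qed
    ultimately show ?thesis by (simp add: card_image)
  qed
  have "e True 0 \<notin> range (e False)" using e_eq by blast
  then have "range (e True) \<noteq> range (e False)" by blast
  then have "card (orbits (?A\<lparr>carrier := H\<rparr>) ?V (\<lambda>f. f)) = 2" by (simp add: orbs)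
  then show ?thesis
    unfolding multicirculant_def using con sub cyc card n by (auto simp: orbs intro!: exI[of _ H] exI[of _ n])
qed

section \<open>The classification\<close>

text \<open>Exchanging \<open>r\<close> and \<open>s\<close> reduces the four relations to two. One
  of these, and the odd case of the other, contradict transitivity; the remaining even case is
  \<open>X_graph k\<close>.\<close>

lemma vertex_transitive_T1_imp_X_graph:
  assumes k: "k \<ge> 9" and rs: "\<not> 2 * int k dvd r - s"
    and con: "connected (with_proj (T1 k r s))" and vt: "vertex_transitive (T1 k r s)"
  obtains h where "odd k" "pair_iso h (T1 k r s) (X_graph k)"
proof -
  have k0: "k > 0" using k by simp
  have *: "\<exists>h. odd k \<and> pair_iso h (T1 k r' s') (X_graph k)"
    if rs': "\<not> 2 * int k dvd r' - s'" and con': "connected (with_proj (T1 k r' s'))"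
      and vt': "vertex_transitive (T1 k r' s')"
      and rel: "2 * int k dvd 3 * r' - s' \<or> 2 * int k dvd 2 * r' - 3 * s' + int k" for r' s'
  proof -
    have rel': "2 * int k dvd 2 * r' - 3 * s' + int k"
      using rel not_vertex_transitive_3r[OF k rs' con'] vt' by blast
    moreover have "even r'" using not_vertex_transitive_2r_odd[OF k rs' con' rel'] vt' by blast
    ultimately show ?thesis using T1_iso_X_graph[OF k0 con'] by metis
  qed
  have sw: "T1 k r s = T1 k s r" by (rule T1_swap[OF k0])
  have neg: "2 * int k dvd a - b \<longleftrightarrow> 2 * int k dvd b - a" for a b
    by (rule dvd_diff_commute)
  have "2 * s - 3 * r + int k = 2 * int k - (3 * r - 2 * s + int k)" by simp
  then have "2 * int k dvd 3 * r - 2 * s + int k \<Longrightarrow> 2 * int k dvd 2 * s - 3 * r + int k"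
    using dvd_diff[OF dvd_refl] by (simp only:)
  then have "(2 * int k dvd 3 * r - s \<or> 2 * int k dvd 2 * r - 3 * s + int k) \<or>
    (2 * int k dvd 3 * s - r \<or> 2 * int k dvd 2 * s - 3 * r + int k)"
    using vertex_transitive_T1_relation[OF k rs con vt] neg[of r "3 * s"] by blast
  then have "\<exists>h. odd k \<and> pair_iso h (T1 k r s) (X_graph k)"
    using *[OF rs con vt] *[of s r] rs con vt neg[of r s] sw by metis
  then show ?thesis using that by blast
qed

theorem theorem4p2:
  fixes \<Gamma> :: "'a pair_pre_digraph"
  assumes "pair_graph \<Gamma>"
    and "cubic \<Gamma>"
    and "tricirculant \<Gamma>"
    and "type1 \<Gamma>"
    and "card (pverts \<Gamma>) \<ge> 54"
  shows "(vertex_transitive \<Gamma> \<longleftrightarrow> (\<exists>k::nat. odd k \<and> k \<ge> 9 \<and> digraph_iso \<Gamma> (X_graph k))) \<and>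
    (\<forall>k::nat. odd k \<and> k \<ge> 9 \<and> digraph_iso \<Gamma> (X_graph k) \<and> \<not> 3 dvd k \<longrightarrow>
       bicirculant \<Gamma> \<and>
       (\<exists>\<alpha>::nat. \<alpha> \<in> {1, 2} \<and> \<alpha> mod 3 = k mod 3 \<and>
          digraph_iso \<Gamma> (GP (3 * k) (int k - (-1) ^ \<alpha>))))"
proof -
  interpret pair_graph \<Gamma> by fact
  have wf: "pair_wf_digraph \<Gamma>" by (rule pair_wf_digraph)
  have con: "connected (with_proj \<Gamma>)" and deg: "\<And>v. v \<in> pverts \<Gamma> \<Longrightarrow> card (nbrs \<Gamma> v) = 3"
    using assms(2) by (auto simp: cubic_def out_degree_eq_card_nbrs)
  have vt_imp: "\<exists>k. odd k \<and> k \<ge> 9 \<and> digraph_iso \<Gamma> (X_graph k)" if vt: "vertex_transitive \<Gamma>"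
  proof -
    obtain k r s where k0: "k > 0" and iso: "digraph_iso \<Gamma> (T1 k r s)"
      using assms(4) by (auto simp: type1_def)
    obtain g where g: "pair_iso g \<Gamma> (T1 k r s)"
      using digraph_iso_pair_isoE[OF wf iso] by blast
    have bij: "bij_betw g (pverts \<Gamma>) (pverts (T1 k r s))" using g by (simp add: pair_iso_def)
    have "k \<ge> 9" using bij_betw_same_card[OF bij] assms(5) by (simp add: card_pverts_T1)
    \<comment> \<open>Otherwise \<open>v_0\<close> would have at most two neighbours, against
      cubicity.\<close>
    moreover have "\<not> 2 * int k dvd r - s"
    proof
      assume "2 * int k dvd r - s"
      then have "vtx k TW (0 + r) = vtx k TW (0 + s)" by (simp add: vtx_eq_iff)
      then have "nbrs (T1 k r s) (vtx k TV 0) = {vtx k TU 0, vtx k TW s}"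
        by (simp add: nbrs_T1[OF k0])
      then have "card (nbrs (T1 k r s) (vtx k TV 0)) \<le> 2" by (simp add: card_insert_if)
      moreover obtain v where v: "v \<in> pverts \<Gamma>" "g v = vtx k TV 0"
        using bij vtx_in_T1[OF k0] by (metis bij_betw_imp_surj_on imageE)
      have "card (nbrs (T1 k r s) (g v)) = card (nbrs \<Gamma> v)"
        unfolding nbrs_pair_iso[OF wf pair_wf_T1[OF k0] g v(1)]
        by (rule card_image[OF inj_on_subset[OF pair_iso_inj[OF g] nbrs_subset[OF wf]]])
      ultimately show False using deg v by simp
    qed
    moreover have "connected (with_proj (T1 k r s))" by (rule connected_digraph_iso[OF wf con iso])
    moreover have "vertex_transitive (T1 k r s)"
      by (rule vertex_transitive_pair_iso[OF pair_iso_inv_into[OF g] vt])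
    ultimately obtain h where h: "odd k" "pair_iso h (T1 k r s) (X_graph k)"
      by (rule vertex_transitive_T1_imp_X_graph)
    have "digraph_iso \<Gamma> (X_graph k)"
      using pair_iso_comp[OF g h(2)] pair_wf_T1[OF k0]
      by (intro digraph_iso_if_pair_iso[OF wf]) (auto simp: X_graph_def)
    then show ?thesis using h(1) \<open>k \<ge> 9\<close> by blast
  qed
  have vt_if: "vertex_transitive \<Gamma>" if "odd k" "digraph_iso \<Gamma> (X_graph k)" for k
    using digraph_iso_pair_isoE[OF wf that(2)] vertex_transitive_pair_iso vertex_transitive_X_graph[OF that(1)]
    by blast
  have "bicirculant \<Gamma> \<and> (\<exists>\<alpha>::nat. \<alpha> \<in> {1, 2} \<and> \<alpha> mod 3 = k mod 3 \<and>
          digraph_iso \<Gamma> (GP (3 * k) (int k - (-1) ^ \<alpha>)))"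
    if k: "odd k" "k \<ge> 9" and iso: "digraph_iso \<Gamma> (X_graph k)" and k3: "\<not> 3 dvd k" for k
  proof -
    obtain g where g: "pair_iso g \<Gamma> (X_graph k)" using digraph_iso_pair_isoE[OF wf iso] by blast
    have conX: "connected (with_proj (T1 k (r_star k) 1))"
      using connected_digraph_iso[OF wf con iso] by (simp add: X_graph_def)
    \<comment> \<open>For \<open>k = 3q + 1\<close> take \<open>c = q\<close>, so that
      \<open>3c + 2 = k + 1\<close>. For \<open>k = 3q + 2\<close> take \<open>c = - q - 1\<close>,
      so that \<open>3c + 1 = - k\<close> and \<open>3c + 2 = 1 - k\<close>.\<close>
    obtain \<alpha> c where \<alpha>: "\<alpha> \<in> {1, 2}" "\<alpha> mod 3 = k mod 3"
      and c: "3 * c + 1 = int k \<or> 3 * c + 1 = - int k"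
        "int k - (-1) ^ \<alpha> = 3 * c + 2 \<or> int k - (-1) ^ \<alpha> = - (3 * c + 2)"
    proof (cases "k mod 3 = 1")
      case True
      then have "3 * (int k div 3) + 1 = int k" by presburger
      then show ?thesis using that[of 1 "int k div 3"] True by simp
    next
      case False
      then have "k mod 3 = 2" using k3 by presburger
      moreover from this have "3 * (- (int k div 3) - 1) + 1 = - int k" by presburger
      ultimately show ?thesis using that[of 2 "- (int k div 3) - 1"] by simp
    qed
    let ?P = "GP (3 * k) (int k - (-1) ^ \<alpha>)"
    obtain h where h: "pair_iso h ?P (X_graph k)"
      using GP_iso_T1[OF k(1) r_star[OF k(1)] conX c] unfolding X_graph_def by blast
    have "pair_iso (inv_into (pverts ?P) h \<circ> g) \<Gamma> ?P"
      by (rule pair_iso_comp[OF g pair_iso_inv_into[OF h]])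
    moreover have wfP: "pair_wf_digraph ?P" using k(2) by (intro pair_wf_GP) simp
    ultimately have "digraph_iso \<Gamma> ?P" by (intro digraph_iso_if_pair_iso[OF wf])
    moreover have "bicirculant \<Gamma>"
      using bicirculant_if_GP_iso[OF con _ pair_iso_comp[OF h pair_iso_inv_into[OF g]]] k(2) by simp
    ultimately show ?thesis using \<alpha> by blast
  qed
  then show ?thesis using vt_imp vt_if by blast
qed

end
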